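(* Let $\mathcal C$ be a semisimple rigid balanced braided tensor category over $\mathbb C$ with simple unit $\mathbf 1$ and let $A$ be a $\mathcal C$-algebra. Then $\mathrm{Rep}\,A$ is a module category over $\mathcal C$, i.e. there is an additive functor $\boxtimes:\mathcal C\times\mathrm{Rep}\,A\to\mathrm{Rep}\,A$ and isomorphisms $$(V_1\otimes V_2)\boxtimes X\simeq V_1\boxtimes(V_2\boxtimes X),\quad V_1,V_2\in\mathcal C,\ X\in\mathrm{Rep}\,A,\qquad \mathbf 1\boxtimes X\simeq X,\quad X\in\mathrm{Rep}\,A,$$ satisfying the usual compatibility conditions.
   Context: $\mathcal C$ has finite-dimensional Hom spaces and braiding $R_{V,W}:V\otimes W\to W\otimes V$. A $\mathcal C$-algebra is an object $A\in\mathcal C$ with morphisms $\mu:A\otimes A\to A$ and $\iota_A:\mathbf 1\hookrightarrow A$ such that $\mu(\mu\otimes \mathrm{id})=\mu(\mathrm{id}\otimes\mu)$, $\mu R_{A,A}=\mu$, $\mu(\iota_A\otimes\mathrm{id}_A)=\mathrm{id}_A$, and $\dim\mathrm{Hom}_{\mathcal C}(\mathbf 1,A)=1$. $\mathrm{Rep}\,A$ has objects $(V,\mu_V)$ with $V\in\mathcal C$ and $\mu_V:A\otimes V\to V$ satisfying $\mu_V(\mu\otimes\mathrm{id})=\mu_V(\mathrm{id}\otimes\mu_V)$ and $\mu_V(\iota_A\otimes\mathrm{id})=\mathrm{id}$; morphisms are $\mathcal C$-morphisms commuting with the action. The usual compatibility conditions are the pentagon and unit axioms of a module category over a monoidal category.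 *)

theory Defs
  imports "Jordan_Normal_Form.VS_Connect"
begin

section \<open>Categories linear over the complex numbers\<close>

text \<open>Composition is written in the usual order: \<open>g \<cdot> f\<close> is ``first f, then g''. \<open>Zero X Y\<close> is the zero
  morphism from X to Y. Nothing is required of the operations outside the sets of objects and
  arrows.\<close>

record ('o, 'm) lin_cat =
  Obj :: "'o set"
  Arr :: "'m set"
  Dom :: "'m \<Rightarrow> 'o"
  Cod :: "'m \<Rightarrow> 'o"
  Id :: "'o \<Rightarrow> 'm"
  Comp :: "'m \<Rightarrow> 'm \<Rightarrow> 'm"  (infixr \<open>\<cdot>\<index>\<close> 70)
  Zero :: "'o \<Rightarrow> 'o \<Rightarrow> 'm"
  Add :: "'m \<Rightarrow> 'm \<Rightarrow> 'm"
  Smult :: "complex \<Rightarrow> 'm \<Rightarrow> 'm"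

definition Hom :: "('o, 'm, 'z) lin_cat_scheme \<Rightarrow> 'o \<Rightarrow> 'o \<Rightarrow> 'm set" where
  "Hom C X Y = {f \<in> Arr C. Dom C f = X \<and> Cod C f = Y}"

locale category =
  fixes C (structure)
  assumes Dom_Obj: "f \<in> Arr C \<Longrightarrow> Dom C f \<in> Obj C"
    and Cod_Obj: "f \<in> Arr C \<Longrightarrow> Cod C f \<in> Obj C"
    and Id_Hom: "X \<in> Obj C \<Longrightarrow> Id C X \<in> Hom C X X"
    and Comp_Hom: "\<lbrakk>f \<in> Hom C X Y; g \<in> Hom C Y Z\<rbrakk> \<Longrightarrow> g \<cdot> f \<in> Hom C X Z"
    and Comp_Id: "f \<in> Hom C X Y \<Longrightarrow> f \<cdot> Id C X = f"
    and Id_Comp: "f \<in> Hom C X Y \<Longrightarrow> Id C Y \<cdot> f = f"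
    and Comp_assoc: "\<lbrakk>f \<in> Hom C X Y; g \<in> Hom C Y Z; h \<in> Hom C Z W\<rbrakk>
      \<Longrightarrow> (h \<cdot> g) \<cdot> f = h \<cdot> (g \<cdot> f)"

definition is_inverse :: "('o, 'm, 'z) lin_cat_scheme \<Rightarrow> 'm \<Rightarrow> 'm \<Rightarrow> bool" where
  "is_inverse C f g \<longleftrightarrow> g \<in> Hom C (Cod C f) (Dom C f) \<and>
     g \<cdot>\<^bsub>C\<^esub> f = Id C (Dom C f) \<and> f \<cdot>\<^bsub>C\<^esub> g = Id C (Cod C f)"

definition Iso :: "('o, 'm, 'z) lin_cat_scheme \<Rightarrow> 'o \<Rightarrow> 'o \<Rightarrow> 'm set" where
  "Iso C X Y = {f \<in> Hom C X Y. \<exists>g. is_inverse C f g}"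

definition Inv :: "('o, 'm, 'z) lin_cat_scheme \<Rightarrow> 'm \<Rightarrow> 'm" where
  "Inv C f = (THE g. is_inverse C f g)"

definition is_mono :: "('o, 'm, 'z) lin_cat_scheme \<Rightarrow> 'm \<Rightarrow> bool" where
  "is_mono C f \<longleftrightarrow> f \<in> Arr C \<and>
     (\<forall>X \<in> Obj C. \<forall>g \<in> Hom C X (Dom C f). \<forall>h \<in> Hom C X (Dom C f). f \<cdot>\<^bsub>C\<^esub> g = f \<cdot>\<^bsub>C\<^esub> h \<longrightarrow> g = h)"

definition is_epi :: "('o, 'm, 'z) lin_cat_scheme \<Rightarrow> 'm \<Rightarrow> bool" where
  "is_epi C f \<longleftrightarrow> f \<in> Arr C \<and>
     (\<forall>Y \<in> Obj C. \<forall>g \<in> Hom C (Cod C f) Y. \<forall>h \<in> Hom C (Cod C f) Y. g \<cdot>\<^bsub>C\<^esub> f = h \<cdot>\<^bsub>C\<^esub> f \<longrightarrow> g = h)"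

text \<open>The Hom set as a complex vector space. The fields \<open>mult\<close> and \<open>one\<close> play no role in
  \<^locale>\<open>vectorspace\<close>; they are only there because its records extend those of rings.\<close>

definition hom_space :: "('o, 'm, 'z) lin_cat_scheme \<Rightarrow> 'o \<Rightarrow> 'o \<Rightarrow> (complex, 'm) module" where
  "hom_space C X Y = \<lparr>carrier = Hom C X Y, mult = (\<lambda>_ _. Zero C X Y), one = Zero C X Y,
     zero = Zero C X Y, add = Add C, smult = Smult C\<rparr>"

abbreviation complex_field :: "complex ring" where
  "complex_field \<equiv> class_ring"

locale linear_category = category +
  assumes Hom_vectorspace: "\<lbrakk>X \<in> Obj C; Y \<in> Obj C\<rbrakk> \<Longrightarrow> vectorspace complex_field (hom_space C X Y)"
    and Comp_Add_left: "\<lbrakk>f \<in> Hom C X Y; g \<in> Hom C Y Z; g' \<in> Hom C Y Z\<rbrakk>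
      \<Longrightarrow> Add C g g' \<cdot> f = Add C (g \<cdot> f) (g' \<cdot> f)"
    and Comp_Add_right: "\<lbrakk>f \<in> Hom C X Y; f' \<in> Hom C X Y; g \<in> Hom C Y Z\<rbrakk>
      \<Longrightarrow> g \<cdot> Add C f f' = Add C (g \<cdot> f) (g \<cdot> f')"
    and Comp_Smult_left: "\<lbrakk>f \<in> Hom C X Y; g \<in> Hom C Y Z\<rbrakk> \<Longrightarrow> Smult C c g \<cdot> f = Smult C c (g \<cdot> f)"
    and Comp_Smult_right: "\<lbrakk>f \<in> Hom C X Y; g \<in> Hom C Y Z\<rbrakk> \<Longrightarrow> g \<cdot> Smult C c f = Smult C c (g \<cdot> f)"

definition is_zero_object :: "('o, 'm, 'z) lin_cat_scheme \<Rightarrow> 'o \<Rightarrow> bool" where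
  "is_zero_object C Z \<longleftrightarrow> Z \<in> Obj C \<and>
     (\<forall>X \<in> Obj C. (\<exists>!f. f \<in> Hom C X Z) \<and> (\<exists>!f. f \<in> Hom C Z X))"

definition is_direct_sum ::
  "('o, 'm, 'z) lin_cat_scheme \<Rightarrow> nat \<Rightarrow> (nat \<Rightarrow> 'o) \<Rightarrow> 'o \<Rightarrow> bool" where
  "is_direct_sum C n S X \<longleftrightarrow> X \<in> Obj C \<and> (\<forall>j<n. S j \<in> Obj C) \<and>
     (\<exists>i p. (\<forall>j<n. i j \<in> Hom C (S j) X \<and> p j \<in> Hom C X (S j)) \<and>
        (\<forall>j<n. \<forall>k<n. p k \<cdot>\<^bsub>C\<^esub> i j = (if j = k then Id C (S j) else Zero C (S j) (S k))) \<and>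
        finsum (hom_space C X X) (\<lambda>j. i j \<cdot>\<^bsub>C\<^esub> p j) {..<n} = Id C X)"

text \<open>Finite direct sums include the empty one, i.e. a zero object.\<close>

locale additive_category = linear_category +
  assumes direct_sum_exists: "(\<And>j. j < n \<Longrightarrow> S j \<in> Obj C) \<Longrightarrow> \<exists>X. is_direct_sum C n S X"

definition is_kernel :: "('o, 'm, 'z) lin_cat_scheme \<Rightarrow> 'm \<Rightarrow> 'm \<Rightarrow> bool" where
  "is_kernel C f k \<longleftrightarrow> k \<in> Arr C \<and> Cod C k = Dom C f \<and>
     f \<cdot>\<^bsub>C\<^esub> k = Zero C (Dom C k) (Cod C f) \<and>
     (\<forall>X \<in> Obj C. \<forall>g \<in> Hom C X (Dom C f). f \<cdot>\<^bsub>C\<^esub> g = Zero C X (Cod C f) \<longrightarrow>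
        (\<exists>!h. h \<in> Hom C X (Dom C k) \<and> k \<cdot>\<^bsub>C\<^esub> h = g))"

definition is_cokernel :: "('o, 'm, 'z) lin_cat_scheme \<Rightarrow> 'm \<Rightarrow> 'm \<Rightarrow> bool" where
  "is_cokernel C f q \<longleftrightarrow> q \<in> Arr C \<and> Dom C q = Cod C f \<and>
     q \<cdot>\<^bsub>C\<^esub> f = Zero C (Dom C f) (Cod C q) \<and>
     (\<forall>Y \<in> Obj C. \<forall>g \<in> Hom C (Cod C f) Y. g \<cdot>\<^bsub>C\<^esub> f = Zero C (Dom C f) Y \<longrightarrow>
        (\<exists>!h. h \<in> Hom C (Cod C q) Y \<and> h \<cdot>\<^bsub>C\<^esub> q = g))"

locale abelian_category = additive_category +
  assumes kernel_exists: "f \<in> Arr C \<Longrightarrow> \<exists>k. is_kernel C f k"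
    and cokernel_exists: "f \<in> Arr C \<Longrightarrow> \<exists>q. is_cokernel C f q"
    and mono_is_kernel: "is_mono C k \<Longrightarrow> \<exists>f \<in> Arr C. is_kernel C f k"
    and epi_is_cokernel: "is_epi C q \<Longrightarrow> \<exists>f \<in> Arr C. is_cokernel C f q"

definition is_simple :: "('o, 'm, 'z) lin_cat_scheme \<Rightarrow> 'o \<Rightarrow> bool" where
  "is_simple C S \<longleftrightarrow> S \<in> Obj C \<and> \<not> is_zero_object C S \<and>
     (\<forall>f. is_mono C f \<and> Cod C f = S \<longrightarrow> is_zero_object C (Dom C f) \<or> f \<in> Iso C (Dom C f) S)"

locale semisimple_category = abelian_category +
  assumes semisimple: "X \<in> Obj C \<Longrightarrow> \<exists>n S. (\<forall>j<n. is_simple C (S j)) \<and> is_direct_sum C n S X"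


section \<open>Functors of two variables\<close>

locale bifunctor = B: category B + C: category C + D: category D
  for B (structure) and C (structure) and D (structure) +
  fixes Fo :: "'b \<Rightarrow> 'c \<Rightarrow> 'd" and Fm :: "'f \<Rightarrow> 'g \<Rightarrow> 'h"
  assumes Fo_Obj: "\<lbrakk>X \<in> Obj B; Y \<in> Obj C\<rbrakk> \<Longrightarrow> Fo X Y \<in> Obj D"
    and Fm_Hom: "\<lbrakk>f \<in> Hom B X X'; g \<in> Hom C Y Y'\<rbrakk> \<Longrightarrow> Fm f g \<in> Hom D (Fo X Y) (Fo X' Y')"
    and Fm_Id: "\<lbrakk>X \<in> Obj B; Y \<in> Obj C\<rbrakk> \<Longrightarrow> Fm (Id B X) (Id C Y) = Id D (Fo X Y)"
    and Fm_Comp: "\<lbrakk>f \<in> Hom B X X'; f' \<in> Hom B X' X''; g \<in> Hom C Y Y'; g' \<in> Hom C Y' Y''\<rbrakk>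
      \<Longrightarrow> Fm (f' \<cdot>\<^bsub>B\<^esub> f) (g' \<cdot>\<^bsub>C\<^esub> g) = Fm f' g' \<cdot>\<^bsub>D\<^esub> Fm f g"

text \<open>As usual, additivity of a functor of two variables means additivity in each variable.\<close>

locale additive_bifunctor = bifunctor + B: linear_category B + C: linear_category C +
    D: linear_category D +
  assumes Fm_Add_left: "\<lbrakk>f \<in> Hom B X X'; f' \<in> Hom B X X'; g \<in> Hom C Y Y'\<rbrakk>
      \<Longrightarrow> Fm (Add B f f') g = Add D (Fm f g) (Fm f' g)"
    and Fm_Add_right: "\<lbrakk>f \<in> Hom B X X'; g \<in> Hom C Y Y'; g' \<in> Hom C Y Y'\<rbrakk>
      \<Longrightarrow> Fm f (Add C g g') = Add D (Fm f g) (Fm f g')"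

locale bilinear_bifunctor = additive_bifunctor +
  assumes Fm_Smult_left: "\<lbrakk>f \<in> Hom B X X'; g \<in> Hom C Y Y'\<rbrakk>
      \<Longrightarrow> Fm (Smult B c f) g = Smult D c (Fm f g)"
    and Fm_Smult_right: "\<lbrakk>f \<in> Hom B X X'; g \<in> Hom C Y Y'\<rbrakk>
      \<Longrightarrow> Fm f (Smult C c g) = Smult D c (Fm f g)"


section \<open>Tensor categories\<close>

text \<open>\<open>Assoc U V W\<close> goes from \<open>(U \<otimes> V) \<otimes> W\<close> to \<open>U \<otimes> (V \<otimes> W)\<close>, \<open>LUnit V\<close> from \<open>1 \<otimes> V\<close> to \<open>V\<close>,
  \<open>RUnit V\<close> from \<open>V \<otimes> 1\<close> to \<open>V\<close>.\<close>

record ('o, 'm) mon_cat = "('o, 'm) lin_cat" +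
  TensO :: "'o \<Rightarrow> 'o \<Rightarrow> 'o"  (infixl \<open>\<otimes>\<^sub>o\<index>\<close> 75)
  TensM :: "'m \<Rightarrow> 'm \<Rightarrow> 'm"  (infixl \<open>\<otimes>\<^sub>m\<index>\<close> 75)
  Unit :: "'o"
  Assoc :: "'o \<Rightarrow> 'o \<Rightarrow> 'o \<Rightarrow> 'm"
  LUnit :: "'o \<Rightarrow> 'm"
  RUnit :: "'o \<Rightarrow> 'm"

locale monoidal_category = bifunctor C C C "TensO C" "TensM C"
  for C (structure) +
  assumes Unit_Obj: "Unit C \<in> Obj C"
    and Assoc_Iso: "\<lbrakk>U \<in> Obj C; V \<in> Obj C; W \<in> Obj C\<rbrakk>
      \<Longrightarrow> Assoc C U V W \<in> Iso C ((U \<otimes>\<^sub>o V) \<otimes>\<^sub>o W) (U \<otimes>\<^sub>o (V \<otimes>\<^sub>o W))"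
    and Assoc_natural: "\<lbrakk>f \<in> Hom C U U'; g \<in> Hom C V V'; h \<in> Hom C W W'\<rbrakk>
      \<Longrightarrow> Assoc C U' V' W' \<cdot> ((f \<otimes>\<^sub>m g) \<otimes>\<^sub>m h) = (f \<otimes>\<^sub>m (g \<otimes>\<^sub>m h)) \<cdot> Assoc C U V W"
    and LUnit_Iso: "V \<in> Obj C \<Longrightarrow> LUnit C V \<in> Iso C (Unit C \<otimes>\<^sub>o V) V"
    and LUnit_natural: "f \<in> Hom C V W \<Longrightarrow> LUnit C W \<cdot> (Id C (Unit C) \<otimes>\<^sub>m f) = f \<cdot> LUnit C V"
    and RUnit_Iso: "V \<in> Obj C \<Longrightarrow> RUnit C V \<in> Iso C (V \<otimes>\<^sub>o Unit C) V"
    and RUnit_natural: "f \<in> Hom C V W \<Longrightarrow> RUnit C W \<cdot> (f \<otimes>\<^sub>m Id C (Unit C)) = f \<cdot> RUnit C V"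
    and pentagon: "\<lbrakk>T \<in> Obj C; U \<in> Obj C; V \<in> Obj C; W \<in> Obj C\<rbrakk>
      \<Longrightarrow> Assoc C T U (V \<otimes>\<^sub>o W) \<cdot> Assoc C (T \<otimes>\<^sub>o U) V W =
        (Id C T \<otimes>\<^sub>m Assoc C U V W) \<cdot> Assoc C T (U \<otimes>\<^sub>o V) W \<cdot> (Assoc C T U V \<otimes>\<^sub>m Id C W)"
    and triangle: "\<lbrakk>V \<in> Obj C; W \<in> Obj C\<rbrakk>
      \<Longrightarrow> (Id C V \<otimes>\<^sub>m LUnit C W) \<cdot> Assoc C V (Unit C) W = RUnit C V \<otimes>\<^sub>m Id C W"

locale tensor_category = monoidal_category C + additive_category C +
    bilinear_bifunctor C C C "TensO C" "TensM C"
  for C (structure)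

text \<open>\<open>e\<close> is the evaluation \<open>V' \<otimes> V \<rightarrow> 1\<close>, \<open>i\<close> the coevaluation \<open>1 \<rightarrow> V \<otimes> V'\<close>; the last two conjuncts are
  the zig-zag identities. The object \<open>V'\<close> is then left dual to \<open>V\<close>, and \<open>V\<close> is right dual to \<open>V'\<close>.\<close>

definition is_left_dual :: "('o, 'm, 'z) mon_cat_scheme \<Rightarrow> 'o \<Rightarrow> 'o \<Rightarrow> bool" where
  "is_left_dual C V V' \<longleftrightarrow> V \<in> Obj C \<and> V' \<in> Obj C \<and>
     (\<exists>e \<in> Hom C (V' \<otimes>\<^sub>o\<^bsub>C\<^esub> V) (Unit C). \<exists>i \<in> Hom C (Unit C) (V \<otimes>\<^sub>o\<^bsub>C\<^esub> V').
        RUnit C V \<cdot>\<^bsub>C\<^esub> (Id C V \<otimes>\<^sub>m\<^bsub>C\<^esub> e) \<cdot>\<^bsub>C\<^esub> Assoc C V V' V \<cdot>\<^bsub>C\<^esub> (i \<otimes>\<^sub>m\<^bsub>C\<^esub> Id C V) = LUnit C V \<and>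
        LUnit C V' \<cdot>\<^bsub>C\<^esub> (e \<otimes>\<^sub>m\<^bsub>C\<^esub> Id C V') \<cdot>\<^bsub>C\<^esub> Inv C (Assoc C V' V V') \<cdot>\<^bsub>C\<^esub> (Id C V' \<otimes>\<^sub>m\<^bsub>C\<^esub> i)
          = RUnit C V')"

locale rigid_category = monoidal_category +
  assumes left_dual_exists: "V \<in> Obj C \<Longrightarrow> \<exists>V'. is_left_dual C V V'"
    and right_dual_exists: "V \<in> Obj C \<Longrightarrow> \<exists>V'. is_left_dual C V' V"

record ('o, 'm) bal_cat = "('o, 'm) mon_cat" +
  Braid :: "'o \<Rightarrow> 'o \<Rightarrow> 'm"
  Twist :: "'o \<Rightarrow> 'm"

locale braided_category = monoidal_category C for C :: "('o, 'm, 'z) bal_cat_scheme" (structure) +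
  assumes Braid_Iso: "\<lbrakk>V \<in> Obj C; W \<in> Obj C\<rbrakk> \<Longrightarrow> Braid C V W \<in> Iso C (V \<otimes>\<^sub>o W) (W \<otimes>\<^sub>o V)"
    and Braid_natural: "\<lbrakk>f \<in> Hom C V V'; g \<in> Hom C W W'\<rbrakk>
      \<Longrightarrow> Braid C V' W' \<cdot> (f \<otimes>\<^sub>m g) = (g \<otimes>\<^sub>m f) \<cdot> Braid C V W"
    and hexagon1: "\<lbrakk>U \<in> Obj C; V \<in> Obj C; W \<in> Obj C\<rbrakk>
      \<Longrightarrow> Assoc C V W U \<cdot> Braid C U (V \<otimes>\<^sub>o W) \<cdot> Assoc C U V W =
        (Id C V \<otimes>\<^sub>m Braid C U W) \<cdot> Assoc C V U W \<cdot> (Braid C U V \<otimes>\<^sub>m Id C W)"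
    and hexagon2: "\<lbrakk>U \<in> Obj C; V \<in> Obj C; W \<in> Obj C\<rbrakk>
      \<Longrightarrow> Inv C (Assoc C W U V) \<cdot> Braid C (U \<otimes>\<^sub>o V) W \<cdot> Inv C (Assoc C U V W) =
        (Braid C U W \<otimes>\<^sub>m Id C V) \<cdot> Inv C (Assoc C U W V) \<cdot> (Id C U \<otimes>\<^sub>m Braid C V W)"

text \<open>Balanced in the sense of Joyal and Street. The further condition that the twist be compatible
  with duals, which distinguishes ribbon categories among these, is not imposed.\<close>

locale balanced_category = braided_category +
  assumes Twist_Iso: "V \<in> Obj C \<Longrightarrow> Twist C V \<in> Iso C V V"
    and Twist_natural: "f \<in> Hom C V W \<Longrightarrow> Twist C W \<cdot> f = f \<cdot> Twist C V"
    and Twist_Unit: "Twist C (Unit C) = Id C (Unit C)"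
    and balancing: "\<lbrakk>V \<in> Obj C; W \<in> Obj C\<rbrakk>
      \<Longrightarrow> Twist C (V \<otimes>\<^sub>o W) = Braid C W V \<cdot> Braid C V W \<cdot> (Twist C V \<otimes>\<^sub>m Twist C W)"

locale semisimple_rigid_balanced_braided_tensor_category =
  tensor_category C + semisimple_category C + rigid_category C + balanced_category C
  for C :: "('o, 'm, 'z) bal_cat_scheme" (structure) +
  assumes Hom_fin_dim: "\<lbrakk>X \<in> Obj C; Y \<in> Obj C\<rbrakk>
      \<Longrightarrow> vectorspace.fin_dim complex_field (hom_space C X Y)"


section \<open>Algebras in a braided tensor category and their modules\<close>

record ('o, 'm) cat_algebra =
  AObj :: 'o
  AMult :: 'm
  AUnit :: 'm

locale C_algebra =
  fixes C :: "('o, 'm, 'z) bal_cat_scheme" (structure)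
    and A :: "('o, 'm, 'y) cat_algebra_scheme"
  assumes AObj_Obj: "AObj A \<in> Obj C"
    and AMult_Hom: "AMult A \<in> Hom C (AObj A \<otimes>\<^sub>o AObj A) (AObj A)"
    and AUnit_Hom: "AUnit A \<in> Hom C (Unit C) (AObj A)"
    and AUnit_mono: "is_mono C (AUnit A)"
    and AMult_assoc: "AMult A \<cdot> (AMult A \<otimes>\<^sub>m Id C (AObj A)) =
      AMult A \<cdot> (Id C (AObj A) \<otimes>\<^sub>m AMult A) \<cdot> Assoc C (AObj A) (AObj A) (AObj A)"
    and AMult_comm: "AMult A \<cdot> Braid C (AObj A) (AObj A) = AMult A"
    and AMult_unit: "AMult A \<cdot> (AUnit A \<otimes>\<^sub>m Id C (AObj A)) = LUnit C (AObj A)"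
    and dim_Hom_Unit: "vectorspace.dim complex_field (hom_space C (Unit C) (AObj A)) = 1"

definition Rep_Obj ::
  "('o, 'm, 'z) mon_cat_scheme \<Rightarrow> ('o, 'm, 'y) cat_algebra_scheme \<Rightarrow> ('o \<times> 'm) set" where
  "Rep_Obj C A = {(V, m). V \<in> Obj C \<and> m \<in> Hom C (AObj A \<otimes>\<^sub>o\<^bsub>C\<^esub> V) V \<and>
     m \<cdot>\<^bsub>C\<^esub> (AMult A \<otimes>\<^sub>m\<^bsub>C\<^esub> Id C V) =
       m \<cdot>\<^bsub>C\<^esub> (Id C (AObj A) \<otimes>\<^sub>m\<^bsub>C\<^esub> m) \<cdot>\<^bsub>C\<^esub> Assoc C (AObj A) (AObj A) V \<and>
     m \<cdot>\<^bsub>C\<^esub> (AUnit A \<otimes>\<^sub>m\<^bsub>C\<^esub> Id C V) = LUnit C V}"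

text \<open>An arrow of Rep A is a triple \<open>(X, f, Y)\<close>: the same morphism f of C may be a homomorphism
  between several pairs of modules.\<close>

definition Rep :: "('o, 'm, 'z) mon_cat_scheme \<Rightarrow> ('o, 'm, 'y) cat_algebra_scheme \<Rightarrow>
    ('o \<times> 'm, ('o \<times> 'm) \<times> 'm \<times> ('o \<times> 'm)) lin_cat" where
  "Rep C A =
    \<lparr>Obj = Rep_Obj C A,
     Arr = {(X, f, Y). X \<in> Rep_Obj C A \<and> Y \<in> Rep_Obj C A \<and> f \<in> Hom C (fst X) (fst Y) \<and>
              f \<cdot>\<^bsub>C\<^esub> snd X = snd Y \<cdot>\<^bsub>C\<^esub> (Id C (AObj A) \<otimes>\<^sub>m\<^bsub>C\<^esub> f)},
     Dom = (\<lambda>(X, f, Y). X),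
     Cod = (\<lambda>(X, f, Y). Y),
     Id = (\<lambda>X. (X, Id C (fst X), X)),
     Comp = (\<lambda>(Y, g, Z) (X, f, Y'). (X, g \<cdot>\<^bsub>C\<^esub> f, Z)),
     Zero = (\<lambda>X Y. (X, Zero C (fst X) (fst Y), Y)),
     Add = (\<lambda>(X, f, Y) (X', g, Y'). (X, Add C f g, Y)),
     Smult = (\<lambda>c (X, f, Y). (X, Smult C c f, Y))\<rparr>"


section \<open>Module categories\<close>

locale module_category =
  C: tensor_category C + M: additive_category M + act: additive_bifunctor C M M actO actM
  for C (structure) and M (structure)
    and actO :: "'o \<Rightarrow> 'p \<Rightarrow> 'p"  (infixr \<open>\<boxtimes>\<^sub>o\<close> 75)
    and actM :: "'m \<Rightarrow> 'n \<Rightarrow> 'n"  (infixr \<open>\<boxtimes>\<^sub>m\<close> 75) +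
  fixes actAssoc :: "'o \<Rightarrow> 'o \<Rightarrow> 'p \<Rightarrow> 'n" and actUnit :: "'p \<Rightarrow> 'n"
  assumes actAssoc_Iso: "\<lbrakk>V \<in> Obj C; W \<in> Obj C; X \<in> Obj M\<rbrakk>
      \<Longrightarrow> actAssoc V W X \<in> Iso M ((V \<otimes>\<^sub>o\<^bsub>C\<^esub> W) \<boxtimes>\<^sub>o X) (V \<boxtimes>\<^sub>o (W \<boxtimes>\<^sub>o X))"
    and actAssoc_natural: "\<lbrakk>f \<in> Hom C V V'; g \<in> Hom C W W'; h \<in> Hom M X X'\<rbrakk>
      \<Longrightarrow> actAssoc V' W' X' \<cdot>\<^bsub>M\<^esub> ((f \<otimes>\<^sub>m\<^bsub>C\<^esub> g) \<boxtimes>\<^sub>m h) = (f \<boxtimes>\<^sub>m (g \<boxtimes>\<^sub>m h)) \<cdot>\<^bsub>M\<^esub> actAssoc V W X"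
    and actUnit_Iso: "X \<in> Obj M \<Longrightarrow> actUnit X \<in> Iso M (Unit C \<boxtimes>\<^sub>o X) X"
    and actUnit_natural: "h \<in> Hom M X X'
      \<Longrightarrow> actUnit X' \<cdot>\<^bsub>M\<^esub> (Id C (Unit C) \<boxtimes>\<^sub>m h) = h \<cdot>\<^bsub>M\<^esub> actUnit X"
    and act_pentagon: "\<lbrakk>U \<in> Obj C; V \<in> Obj C; W \<in> Obj C; X \<in> Obj M\<rbrakk>
      \<Longrightarrow> actAssoc U V (W \<boxtimes>\<^sub>o X) \<cdot>\<^bsub>M\<^esub> actAssoc (U \<otimes>\<^sub>o\<^bsub>C\<^esub> V) W X =
        (Id C U \<boxtimes>\<^sub>m actAssoc V W X) \<cdot>\<^bsub>M\<^esub> actAssoc U (V \<otimes>\<^sub>o\<^bsub>C\<^esub> W) X \<cdot>\<^bsub>M\<^esub>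
          (Assoc C U V W \<boxtimes>\<^sub>m Id M X)"
    and act_triangle: "\<lbrakk>V \<in> Obj C; X \<in> Obj M\<rbrakk>
      \<Longrightarrow> (Id C V \<boxtimes>\<^sub>m actUnit X) \<cdot>\<^bsub>M\<^esub> actAssoc V (Unit C) X = RUnit C V \<boxtimes>\<^sub>m Id M X"

end

theory Submission
  imports Defs
begin

text \<open>
  An object \<open>V\<close> of \<open>C\<close> acts on a module \<open>(X, m)\<close> by tensoring on the left: \<open>V \<boxtimes> X\<close> has underlying
  object \<open>V \<otimes> X\<close>, and \<open>A\<close> acts on it by first passing through \<open>V\<close> along the braiding and then acting
  on \<open>X\<close>. The passage is the map \<open>exchange A V X : A \<otimes> (V \<otimes> X) \<rightarrow> V \<otimes> (A \<otimes> X)\<close>, the braiding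
  conjugated by associators. With this choice the associativity and unit isomorphisms of the action are
  the associator and the left unitor of \<open>C\<close> itself, so the module category pentagon and triangle, and
  all naturality squares, are those of \<open>C\<close>. What has to be proved is that the objects and
  morphisms involved lie in \<open>Rep A\<close>.

  Each such claim is a property of \<open>exchange U V X\<close> under replacing \<open>U\<close> or \<open>V\<close> by a tensor product or
  by the unit. Multiplicativity in \<open>U\<close> (\<open>exchange_tensor_left\<close>, from the hexagon for a braiding
  \<open>(U \<otimes> U') \<otimes> V \<rightarrow> V \<otimes> (U \<otimes> U')\<close>) makes the new action associative, and the case \<open>U = 1\<close>
  (\<open>exchange_Unit_left\<close>) makes it unital. Multiplicativity in \<open>V\<close> (\<open>exchange_tensor_right\<close>, from the
  other hexagon) says that the associator is a module map, and the case \<open>V = 1\<close>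
  (\<open>exchange_Unit_right\<close>) says the same of the left unitor. The unit cases rest on the coherence facts
  \<open>LUnit_tensor\<close>, \<open>LUnit_Braid\<close> and \<open>RUnit_Braid\<close>, which are derived here from the axioms.

  It remains that \<open>Rep A\<close> is an additive category. Its Hom sets are subspaces of those of \<open>C\<close>. A direct
  sum of modules is formed on the direct sum \<open>X\<close> in \<open>C\<close> of the underlying objects, with action
  \<open>\<Sum>\<^sub>j i\<^sub>j \<cdot> m\<^sub>j \<cdot> (id \<otimes> p\<^sub>j)\<close>; as the tensor product preserves direct sums, the module axioms for it may
  be tested on the summands.
\<close>

section \<open>Categories and inverses\<close>

text \<open>A source and a target that occur only in a premise \<open>f \<in> Hom C X Y\<close> block conditional rewriting,
  since the simplifier would have to guess them. The rules below therefore speak of \<^const>\<open>Dom\<close> and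
  \<^const>\<open>Cod\<close>, which it can compute.\<close>

lemma Hom_iff: "f \<in> Hom C X Y \<longleftrightarrow> f \<in> Arr C \<and> Dom C f = X \<and> Cod C f = Y"
  by (auto simp: Hom_def)

context category
begin

lemma Comp_typing [simp]:
  assumes "f \<in> Arr C" "g \<in> Arr C" "Cod C f = Dom C g"
  shows "g \<cdot> f \<in> Arr C" "Dom C (g \<cdot> f) = Dom C f" "Cod C (g \<cdot> f) = Cod C g"
  using Comp_Hom[of f "Dom C f" "Cod C f" g "Cod C g"] assms by (auto simp: Hom_iff)

lemma Id_typing [simp]:
  assumes "X \<in> Obj C"
  shows "Id C X \<in> Arr C" "Dom C (Id C X) = X" "Cod C (Id C X) = X"
  using Id_Hom[OF assms] by (auto simp: Hom_iff)

lemma Dom_Obj' [simp]: "f \<in> Arr C \<Longrightarrow> Dom C f \<in> Obj C"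
  and Cod_Obj' [simp]: "f \<in> Arr C \<Longrightarrow> Cod C f \<in> Obj C"
  by (fact Dom_Obj Cod_Obj)+

lemma comp_id [simp]: "\<lbrakk>f \<in> Arr C; Dom C f = X\<rbrakk> \<Longrightarrow> f \<cdot> Id C X = f"
  and id_comp [simp]: "\<lbrakk>f \<in> Arr C; Cod C f = X\<rbrakk> \<Longrightarrow> Id C X \<cdot> f = f"
  by (auto intro: Comp_Id Id_Comp simp: Hom_iff)

lemma comp_assoc:
  "\<lbrakk>f \<in> Arr C; g \<in> Arr C; h \<in> Arr C; Cod C f = Dom C g; Cod C g = Dom C h\<rbrakk>
    \<Longrightarrow> (h \<cdot> g) \<cdot> f = h \<cdot> g \<cdot> f"
  using Comp_assoc[of f "Dom C f" "Cod C f" g "Cod C g" h "Cod C h"] by (auto simp: Hom_iff)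

text \<open>Composites are kept nested to the right. In that form an equation between two-step composites
  matches only at the very end of a chain; this rule makes it applicable at the front of any chain.\<close>

lemma comp_eq_prefix:
  assumes "g \<cdot> f = h" "f \<in> Arr C" "g \<in> Arr C" "Cod C f = Dom C g"
    "k \<in> Arr C" "Cod C k = Dom C f"
  shows "g \<cdot> f \<cdot> k = h \<cdot> k"
  using assms comp_assoc by metis

lemma is_inverse_unique:
  assumes "f \<in> Arr C" "is_inverse C f g" "is_inverse C f h"
  shows "g = h"
proof -
  have t: "g \<in> Arr C" "h \<in> Arr C" "Dom C g = Cod C f" "Cod C g = Dom C f"
     "Dom C h = Cod C f" "Cod C h = Dom C f"
    using assms by (auto simp: is_inverse_def Hom_iff)
  have "g = (h \<cdot> f) \<cdot> g"
    using assms t by (simp add: is_inverse_def)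
  also have "\<dots> = h \<cdot> f \<cdot> g"
    using assms t by (simp add: comp_assoc)
  also have "\<dots> = h"
    using assms t by (simp add: is_inverse_def)
  finally show ?thesis .
qed

lemma Inv_eqI: "\<lbrakk>f \<in> Arr C; is_inverse C f g\<rbrakk> \<Longrightarrow> Inv C f = g"
  unfolding Inv_def by (rule the_equality) (auto intro: is_inverse_unique)

lemma Iso_Arr: "f \<in> Iso C X Y \<Longrightarrow> f \<in> Arr C \<and> Dom C f = X \<and> Cod C f = Y"
  by (auto simp: Iso_def Hom_iff)

lemma is_inverse_Inv: "f \<in> Iso C X Y \<Longrightarrow> is_inverse C f (Inv C f)"
  using Inv_eqI unfolding Iso_def by (auto simp: Hom_iff)

lemma Inv_typing:
  assumes "f \<in> Iso C X Y"
  shows "Inv C f \<in> Arr C" "Dom C (Inv C f) = Y" "Cod C (Inv C f) = X"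
    "Inv C f \<cdot> f = Id C X" "f \<cdot> Inv C f = Id C Y"
  using is_inverse_Inv[OF assms] Iso_Arr[OF assms] by (auto simp: is_inverse_def Hom_iff)

lemma Inv_cancel:
  assumes "f \<in> Iso C X Y"
  shows "\<lbrakk>k \<in> Arr C; Cod C k = X\<rbrakk> \<Longrightarrow> Inv C f \<cdot> f \<cdot> k = k"
    and "\<lbrakk>k \<in> Arr C; Cod C k = Y\<rbrakk> \<Longrightarrow> f \<cdot> Inv C f \<cdot> k = k"
  using Inv_typing[OF assms] Iso_Arr[OF assms] by (simp_all flip: comp_assoc)

lemma IsoI:
  assumes "f \<in> Arr C" "g \<in> Arr C" "Dom C f = X" "Cod C f = Y" "Dom C g = Y" "Cod C g = X"
    "g \<cdot> f = Id C X" "f \<cdot> g = Id C Y"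
  shows "f \<in> Iso C X Y"
  using assms by (auto simp: Iso_def Hom_iff is_inverse_def)

lemma Iso_cancel_left:
  assumes "f \<in> Iso C Y Z" "g \<in> Arr C" "h \<in> Arr C" "Cod C g = Y" "Cod C h = Y" "f \<cdot> g = f \<cdot> h"
  shows "g = h"
  by (metis Inv_cancel(1) assms)

lemma Iso_cancel_right:
  assumes "f \<in> Iso C X Y" "g \<in> Arr C" "h \<in> Arr C" "Dom C g = Y" "Dom C h = Y" "g \<cdot> f = h \<cdot> f"
  shows "g = h"
proof -
  have "(g \<cdot> f) \<cdot> Inv C f = (h \<cdot> f) \<cdot> Inv C f" using assms by simp
  then show ?thesis
    using assms(2-5) Inv_typing[OF assms(1)] Iso_Arr[OF assms(1)] by (simp add: comp_assoc)
qed

end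


section \<open>Coherence in monoidal categories\<close>

context monoidal_category
begin

abbreviation \<alpha>' where "\<alpha>' U V W \<equiv> Inv C (Assoc C U V W)"

lemmas Unit_Obj [simp]
lemmas comp_assoc = B.comp_assoc
lemmas comp_eq_prefix = B.comp_eq_prefix

lemma tensor_Obj [simp]: "\<lbrakk>X \<in> Obj C; Y \<in> Obj C\<rbrakk> \<Longrightarrow> X \<otimes>\<^sub>o Y \<in> Obj C"
  by (fact Fo_Obj)

lemma tensor_typing [simp]:
  assumes "f \<in> Arr C" "g \<in> Arr C"
  shows "f \<otimes>\<^sub>m g \<in> Arr C" "Dom C (f \<otimes>\<^sub>m g) = Dom C f \<otimes>\<^sub>o Dom C g"
    "Cod C (f \<otimes>\<^sub>m g) = Cod C f \<otimes>\<^sub>o Cod C g"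
  using Fm_Hom[of f "Dom C f" "Cod C f" g "Dom C g" "Cod C g"] assms by (auto simp: Hom_iff)

lemma tensor_id [simp]: "\<lbrakk>X \<in> Obj C; Y \<in> Obj C\<rbrakk> \<Longrightarrow> Id C X \<otimes>\<^sub>m Id C Y = Id C (X \<otimes>\<^sub>o Y)"
  by (fact Fm_Id)

lemma interchange:
  "\<lbrakk>f \<in> Arr C; f' \<in> Arr C; g \<in> Arr C; g' \<in> Arr C; Cod C f = Dom C f'; Cod C g = Dom C g'\<rbrakk>
    \<Longrightarrow> (f' \<otimes>\<^sub>m g') \<cdot> (f \<otimes>\<^sub>m g) = (f' \<cdot> f) \<otimes>\<^sub>m (g' \<cdot> g)"
  using Fm_Comp[of f "Dom C f" "Cod C f" f' "Cod C f'" g "Dom C g" "Cod C g" g' "Cod C g'"]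
  by (auto simp: Hom_iff)

lemma whisker_left:
  "\<lbrakk>X \<in> Obj C; g \<in> Arr C; f \<in> Arr C; Cod C f = Dom C g\<rbrakk>
    \<Longrightarrow> Id C X \<otimes>\<^sub>m (g \<cdot> f) = (Id C X \<otimes>\<^sub>m g) \<cdot> (Id C X \<otimes>\<^sub>m f)"
  by (simp add: interchange)

lemma whisker_right:
  "\<lbrakk>X \<in> Obj C; g \<in> Arr C; f \<in> Arr C; Cod C f = Dom C g\<rbrakk>
    \<Longrightarrow> (g \<cdot> f) \<otimes>\<^sub>m Id C X = (g \<otimes>\<^sub>m Id C X) \<cdot> (f \<otimes>\<^sub>m Id C X)"
  by (simp add: interchange)

lemma constraint_typing [simp]:
  assumes "U \<in> Obj C" "V \<in> Obj C" "W \<in> Obj C"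
  shows "Assoc C U V W \<in> Arr C" "Dom C (Assoc C U V W) = (U \<otimes>\<^sub>o V) \<otimes>\<^sub>o W"
    "Cod C (Assoc C U V W) = U \<otimes>\<^sub>o (V \<otimes>\<^sub>o W)"
    "\<alpha>' U V W \<in> Arr C" "Cod C (\<alpha>' U V W) = (U \<otimes>\<^sub>o V) \<otimes>\<^sub>o W"
    "Dom C (\<alpha>' U V W) = U \<otimes>\<^sub>o (V \<otimes>\<^sub>o W)"
    "Assoc C U V W \<cdot> \<alpha>' U V W = Id C (U \<otimes>\<^sub>o (V \<otimes>\<^sub>o W))"
    "\<alpha>' U V W \<cdot> Assoc C U V W = Id C ((U \<otimes>\<^sub>o V) \<otimes>\<^sub>o W)"
  using B.Iso_Arr[OF Assoc_Iso[OF assms]] B.Inv_typing[OF Assoc_Iso[OF assms]] by auto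

lemma assoc_cancel [simp]:
  assumes "U \<in> Obj C" "V \<in> Obj C" "W \<in> Obj C" "k \<in> Arr C"
  shows "Cod C k = (U \<otimes>\<^sub>o V) \<otimes>\<^sub>o W \<Longrightarrow> \<alpha>' U V W \<cdot> Assoc C U V W \<cdot> k = k"
    and "Cod C k = U \<otimes>\<^sub>o (V \<otimes>\<^sub>o W) \<Longrightarrow> Assoc C U V W \<cdot> \<alpha>' U V W \<cdot> k = k"
  using B.Inv_cancel[OF Assoc_Iso[OF assms(1,2,3)]] assms(4) by auto

lemma unit_typing [simp]:
  assumes "V \<in> Obj C"
  shows "LUnit C V \<in> Arr C" "Dom C (LUnit C V) = Unit C \<otimes>\<^sub>o V" "Cod C (LUnit C V) = V"
    "RUnit C V \<in> Arr C" "Dom C (RUnit C V) = V \<otimes>\<^sub>o Unit C" "Cod C (RUnit C V) = V"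
  using B.Iso_Arr[OF LUnit_Iso[OF assms]] B.Iso_Arr[OF RUnit_Iso[OF assms]] by auto

lemma assoc_nat:
  "\<lbrakk>f \<in> Arr C; g \<in> Arr C; h \<in> Arr C; Cod C f = U; Cod C g = V; Cod C h = W\<rbrakk>
    \<Longrightarrow> Assoc C U V W \<cdot> ((f \<otimes>\<^sub>m g) \<otimes>\<^sub>m h)
      = (f \<otimes>\<^sub>m (g \<otimes>\<^sub>m h)) \<cdot> Assoc C (Dom C f) (Dom C g) (Dom C h)"
  using Assoc_natural[of f "Dom C f" "Cod C f" g "Dom C g" "Cod C g" h "Dom C h" "Cod C h"]
  by (auto simp: Hom_iff)

lemma assoc_inv_nat:
  assumes "f \<in> Arr C" "g \<in> Arr C" "h \<in> Arr C" "Cod C f = U" "Cod C g = V" "Cod C h = W"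
  shows "\<alpha>' U V W \<cdot> (f \<otimes>\<^sub>m (g \<otimes>\<^sub>m h))
      = ((f \<otimes>\<^sub>m g) \<otimes>\<^sub>m h) \<cdot> \<alpha>' (Dom C f) (Dom C g) (Dom C h)"
proof -
  have o: "U \<in> Obj C" "V \<in> Obj C" "W \<in> Obj C"
    using assms B.Cod_Obj by blast+
  show ?thesis
  proof (rule B.Iso_cancel_left[OF Assoc_Iso[OF o]])
    show "Assoc C U V W \<cdot> \<alpha>' U V W \<cdot> (f \<otimes>\<^sub>m (g \<otimes>\<^sub>m h))
        = Assoc C U V W \<cdot> ((f \<otimes>\<^sub>m g) \<otimes>\<^sub>m h) \<cdot> \<alpha>' (Dom C f) (Dom C g) (Dom C h)"
      using assms o by (simp add: comp_eq_prefix[OF assoc_nat] comp_assoc)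
  qed (use assms o in simp_all)
qed

lemma LUnit_nat: "\<lbrakk>f \<in> Arr C; Cod C f = W\<rbrakk>
    \<Longrightarrow> LUnit C W \<cdot> (Id C (Unit C) \<otimes>\<^sub>m f) = f \<cdot> LUnit C (Dom C f)"
  and RUnit_nat: "\<lbrakk>f \<in> Arr C; Cod C f = W\<rbrakk>
    \<Longrightarrow> RUnit C W \<cdot> (f \<otimes>\<^sub>m Id C (Unit C)) = f \<cdot> RUnit C (Dom C f)"
  using LUnit_natural[of f "Dom C f" "Cod C f"] RUnit_natural[of f "Dom C f" "Cod C f"]
  by (auto simp: Hom_iff)

lemma Unit_tensor_faithful:
  assumes "f \<in> Arr C" "g \<in> Arr C" "Dom C f = Dom C g" "Cod C f = Cod C g"
    "Id C (Unit C) \<otimes>\<^sub>m f = Id C (Unit C) \<otimes>\<^sub>m g"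
  shows "f = g"
  by (rule B.Iso_cancel_right[OF LUnit_Iso[of "Dom C f"]])
    (use assms LUnit_nat[of f "Cod C f"] LUnit_nat[of g "Cod C g"] in simp_all)

lemma tensor_Unit_faithful:
  assumes "f \<in> Arr C" "g \<in> Arr C" "Dom C f = Dom C g" "Cod C f = Cod C g"
    "f \<otimes>\<^sub>m Id C (Unit C) = g \<otimes>\<^sub>m Id C (Unit C)"
  shows "f = g"
  by (rule B.Iso_cancel_right[OF RUnit_Iso[of "Dom C f"]])
    (use assms RUnit_nat[of f "Cod C f"] RUnit_nat[of g "Cod C g"] in simp_all)

text \<open>This is Kelly's consequence of the pentagon and triangle axioms. Tensoring with the unit is faithful,
  so it suffices to compare the two sides after applying \<open>1 \<otimes> -\<close>; the pentagon on \<open>1, 1, U, V\<close> and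
  the triangle reduce both, up to associators, to \<open>r \<otimes> id\<close> on \<open>(1 \<otimes> 1) \<otimes> (U \<otimes> V)\<close>.\<close>

lemma LUnit_tensor:
  assumes [simp]: "U \<in> Obj C" "V \<in> Obj C"
  shows "LUnit C (U \<otimes>\<^sub>o V) \<cdot> Assoc C (Unit C) U V = LUnit C U \<otimes>\<^sub>m Id C V"
proof (rule Unit_tensor_faithful)
  let ?I = "Unit C" and ?a = "Assoc C"
  \<comment> \<open>The first two factors of the three-step side of the pentagon; being invertible, they may be cancelled.\<close>
  let ?b = "?a ?I (?I \<otimes>\<^sub>o U) V \<cdot> (?a ?I ?I U \<otimes>\<^sub>m Id C V)"
  have b: "?b \<in> Iso C (((?I \<otimes>\<^sub>o ?I) \<otimes>\<^sub>o U) \<otimes>\<^sub>o V) (?I \<otimes>\<^sub>o ((?I \<otimes>\<^sub>o U) \<otimes>\<^sub>o V))"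
    by (rule B.IsoI[of _ "(\<alpha>' ?I ?I U \<otimes>\<^sub>m Id C V) \<cdot> \<alpha>' ?I (?I \<otimes>\<^sub>o U) V"])
      (simp_all add: comp_assoc comp_eq_prefix[OF interchange] interchange)
  show "Id C ?I \<otimes>\<^sub>m (LUnit C (U \<otimes>\<^sub>o V) \<cdot> ?a ?I U V) = Id C ?I \<otimes>\<^sub>m (LUnit C U \<otimes>\<^sub>m Id C V)"
  proof (rule B.Iso_cancel_right[OF b])
    have "(Id C ?I \<otimes>\<^sub>m (LUnit C (U \<otimes>\<^sub>o V) \<cdot> ?a ?I U V)) \<cdot> ?b
        = (Id C ?I \<otimes>\<^sub>m LUnit C (U \<otimes>\<^sub>o V)) \<cdot> (Id C ?I \<otimes>\<^sub>m ?a ?I U V) \<cdot> ?b"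
      by (simp add: whisker_left comp_assoc)
    also have "\<dots> = (RUnit C ?I \<otimes>\<^sub>m Id C (U \<otimes>\<^sub>o V)) \<cdot> ?a (?I \<otimes>\<^sub>o ?I) U V"
      by (simp add: pentagon[symmetric] comp_eq_prefix[OF triangle])
    also have "\<dots> = ?a ?I U V \<cdot> ((RUnit C ?I \<otimes>\<^sub>m Id C U) \<otimes>\<^sub>m Id C V)"
      by (simp add: assoc_nat)
    also have "\<dots> = ?a ?I U V \<cdot> (((Id C ?I \<otimes>\<^sub>m LUnit C U) \<cdot> ?a ?I ?I U) \<otimes>\<^sub>m Id C V)"
      by (simp add: triangle)
    also have "\<dots> = (Id C ?I \<otimes>\<^sub>m (LUnit C U \<otimes>\<^sub>m Id C V)) \<cdot> ?b"
      by (simp add: whisker_right comp_eq_prefix[OF assoc_nat] comp_assoc)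
    finally show "(Id C ?I \<otimes>\<^sub>m (LUnit C (U \<otimes>\<^sub>o V) \<cdot> ?a ?I U V)) \<cdot> ?b
      = (Id C ?I \<otimes>\<^sub>m (LUnit C U \<otimes>\<^sub>m Id C V)) \<cdot> ?b" .
  qed simp_all
qed simp_all

lemma LUnit_tensor_inv:
  assumes [simp]: "U \<in> Obj C" "V \<in> Obj C"
  shows "(LUnit C U \<otimes>\<^sub>m Id C V) \<cdot> \<alpha>' (Unit C) U V = LUnit C (U \<otimes>\<^sub>o V)"
  by (simp flip: LUnit_tensor add: comp_assoc)

lemma triangle_inv:
  assumes [simp]: "V \<in> Obj C" "W \<in> Obj C"
  shows "(RUnit C V \<otimes>\<^sub>m Id C W) \<cdot> \<alpha>' V (Unit C) W = Id C V \<otimes>\<^sub>m LUnit C W"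
  by (simp flip: triangle add: comp_assoc)

lemma whisker_assoc_cancel [simp]:
  assumes "T \<in> Obj C" "U \<in> Obj C" "V \<in> Obj C" "W \<in> Obj C"
  shows "(Id C T \<otimes>\<^sub>m Assoc C U V W) \<cdot> (Id C T \<otimes>\<^sub>m \<alpha>' U V W) = Id C (T \<otimes>\<^sub>o (U \<otimes>\<^sub>o (V \<otimes>\<^sub>o W)))"
    "(Id C T \<otimes>\<^sub>m \<alpha>' U V W) \<cdot> (Id C T \<otimes>\<^sub>m Assoc C U V W) = Id C (T \<otimes>\<^sub>o ((U \<otimes>\<^sub>o V) \<otimes>\<^sub>o W))"
    "(Assoc C U V W \<otimes>\<^sub>m Id C T) \<cdot> (\<alpha>' U V W \<otimes>\<^sub>m Id C T) = Id C ((U \<otimes>\<^sub>o (V \<otimes>\<^sub>o W)) \<otimes>\<^sub>o T)"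
    "(\<alpha>' U V W \<otimes>\<^sub>m Id C T) \<cdot> (Assoc C U V W \<otimes>\<^sub>m Id C T) = Id C (((U \<otimes>\<^sub>o V) \<otimes>\<^sub>o W) \<otimes>\<^sub>o T)"
  using assms by (simp_all add: interchange)

lemmas whisker_assoc_cancel_prefix [simp] = whisker_assoc_cancel[THEN comp_eq_prefix]

text \<open>The next three equations are the pentagon solved for different composites, with the associators that
  change sides replaced by their inverses.\<close>

lemma pentagon_assoc_right:
  assumes [simp]: "T \<in> Obj C" "U \<in> Obj C" "V \<in> Obj C" "W \<in> Obj C"
  shows "(Id C T \<otimes>\<^sub>m \<alpha>' U V W) \<cdot> Assoc C T U (V \<otimes>\<^sub>o W)
    = Assoc C T (U \<otimes>\<^sub>o V) W \<cdot> (Assoc C T U V \<otimes>\<^sub>m Id C W) \<cdot> \<alpha>' (T \<otimes>\<^sub>o U) V W"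
proof -
  have "(Id C T \<otimes>\<^sub>m \<alpha>' U V W) \<cdot> Assoc C T U (V \<otimes>\<^sub>o W)
      = (Id C T \<otimes>\<^sub>m \<alpha>' U V W) \<cdot> (Assoc C T U (V \<otimes>\<^sub>o W) \<cdot> Assoc C (T \<otimes>\<^sub>o U) V W) \<cdot> \<alpha>' (T \<otimes>\<^sub>o U) V W"
    by (simp add: comp_assoc)
  also have "\<dots> = Assoc C T (U \<otimes>\<^sub>o V) W \<cdot> (Assoc C T U V \<otimes>\<^sub>m Id C W) \<cdot> \<alpha>' (T \<otimes>\<^sub>o U) V W"
    by (subst pentagon) (simp_all add: comp_assoc)
  finally show ?thesis .
qed

lemma pentagon_assoc_left:
  assumes [simp]: "T \<in> Obj C" "U \<in> Obj C" "V \<in> Obj C" "W \<in> Obj C"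
  shows "Assoc C (T \<otimes>\<^sub>o U) V W \<cdot> (\<alpha>' T U V \<otimes>\<^sub>m Id C W)
    = \<alpha>' T U (V \<otimes>\<^sub>o W) \<cdot> (Id C T \<otimes>\<^sub>m Assoc C U V W) \<cdot> Assoc C T (U \<otimes>\<^sub>o V) W"
proof -
  have "Assoc C (T \<otimes>\<^sub>o U) V W \<cdot> (\<alpha>' T U V \<otimes>\<^sub>m Id C W)
      = \<alpha>' T U (V \<otimes>\<^sub>o W) \<cdot> (Assoc C T U (V \<otimes>\<^sub>o W) \<cdot> Assoc C (T \<otimes>\<^sub>o U) V W) \<cdot> (\<alpha>' T U V \<otimes>\<^sub>m Id C W)"
    by (simp add: comp_assoc)
  also have "\<dots> = \<alpha>' T U (V \<otimes>\<^sub>o W) \<cdot> (Id C T \<otimes>\<^sub>m Assoc C U V W) \<cdot> Assoc C T (U \<otimes>\<^sub>o V) W"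
    by (subst pentagon) (simp_all add: comp_assoc)
  finally show ?thesis .
qed

lemma pentagon_inv:
  assumes [simp]: "T \<in> Obj C" "U \<in> Obj C" "V \<in> Obj C" "W \<in> Obj C"
  shows "\<alpha>' (T \<otimes>\<^sub>o U) V W \<cdot> \<alpha>' T U (V \<otimes>\<^sub>o W)
    = (\<alpha>' T U V \<otimes>\<^sub>m Id C W) \<cdot> \<alpha>' T (U \<otimes>\<^sub>o V) W \<cdot> (Id C T \<otimes>\<^sub>m \<alpha>' U V W)"
proof -
  have "\<alpha>' (T \<otimes>\<^sub>o U) V W \<cdot> \<alpha>' T U (V \<otimes>\<^sub>o W)
      = (\<alpha>' T U V \<otimes>\<^sub>m Id C W) \<cdot> \<alpha>' T (U \<otimes>\<^sub>o V) W
        \<cdot> (Assoc C T (U \<otimes>\<^sub>o V) W \<cdot> (Assoc C T U V \<otimes>\<^sub>m Id C W) \<cdot> \<alpha>' (T \<otimes>\<^sub>o U) V W) \<cdot> \<alpha>' T U (V \<otimes>\<^sub>o W)"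
    by (simp add: comp_assoc)
  also have "\<dots> = (\<alpha>' T U V \<otimes>\<^sub>m Id C W) \<cdot> \<alpha>' T (U \<otimes>\<^sub>o V) W \<cdot> (Id C T \<otimes>\<^sub>m \<alpha>' U V W)"
    by (subst pentagon_assoc_right[symmetric]) (simp_all add: comp_assoc)
  finally show ?thesis .
qed

end


section \<open>The braiding and the unit; moving one factor past another\<close>

context braided_category
begin

lemma Braid_typing [simp]:
  assumes "V \<in> Obj C" "W \<in> Obj C"
  shows "Braid C V W \<in> Arr C" "Dom C (Braid C V W) = V \<otimes>\<^sub>o W" "Cod C (Braid C V W) = W \<otimes>\<^sub>o V"
  using B.Iso_Arr[OF Braid_Iso[OF assms]] by auto

lemma Braid_nat:
  "\<lbrakk>f \<in> Arr C; g \<in> Arr C; Cod C f = V; Cod C g = W\<rbrakk>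
    \<Longrightarrow> Braid C V W \<cdot> (f \<otimes>\<^sub>m g) = (g \<otimes>\<^sub>m f) \<cdot> Braid C (Dom C f) (Dom C g)"
  using Braid_natural[of f "Dom C f" "Cod C f" g "Dom C g" "Cod C g"] by (auto simp: Hom_iff)

text \<open>Specialise the first hexagon to \<open>U, 1, 1\<close> and apply the left unitor at the end. Naturality turns both
  sides into the braiding \<open>U \<otimes> 1 \<rightarrow> 1 \<otimes> U\<close> composed with one side of the claim tensored with \<open>1\<close>;
  the braiding is invertible and \<open>- \<otimes> 1\<close> is faithful.\<close>

lemma LUnit_Braid:
  assumes [simp]: "U \<in> Obj C"
  shows "LUnit C U \<cdot> Braid C U (Unit C) = RUnit C U"
proof (rule tensor_Unit_faithful)
  let ?I = "Unit C"
  let ?R = "Braid C U ?I"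
  have "?R \<cdot> ((LUnit C U \<cdot> ?R) \<otimes>\<^sub>m Id C ?I)
      = ?R \<cdot> (LUnit C U \<otimes>\<^sub>m Id C ?I) \<cdot> (?R \<otimes>\<^sub>m Id C ?I)"
    by (simp add: whisker_right)
  also have "\<dots> = ?R \<cdot> LUnit C (U \<otimes>\<^sub>o ?I) \<cdot> Assoc C ?I U ?I \<cdot> (?R \<otimes>\<^sub>m Id C ?I)"
    by (simp flip: LUnit_tensor add: comp_assoc)
  also have "\<dots> = LUnit C (?I \<otimes>\<^sub>o U) \<cdot> (Id C ?I \<otimes>\<^sub>m ?R) \<cdot> Assoc C ?I U ?I \<cdot> (?R \<otimes>\<^sub>m Id C ?I)"
    by (simp add: comp_eq_prefix[OF LUnit_nat] comp_assoc)
  also have "\<dots> = LUnit C (?I \<otimes>\<^sub>o U) \<cdot> Assoc C ?I ?I U \<cdot> Braid C U (?I \<otimes>\<^sub>o ?I) \<cdot> Assoc C U ?I ?I"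
    by (simp add: hexagon1)
  also have "\<dots> = (LUnit C ?I \<otimes>\<^sub>m Id C U) \<cdot> Braid C U (?I \<otimes>\<^sub>o ?I) \<cdot> Assoc C U ?I ?I"
    by (simp add: comp_eq_prefix[OF LUnit_tensor])
  also have "\<dots> = ?R \<cdot> (Id C U \<otimes>\<^sub>m LUnit C ?I) \<cdot> Assoc C U ?I ?I"
    using comp_eq_prefix[OF Braid_nat[of "Id C U" "LUnit C ?I"]] by (simp add: comp_assoc)
  also have "\<dots> = ?R \<cdot> (RUnit C U \<otimes>\<^sub>m Id C ?I)"
    by (simp add: triangle)
  finally show "(LUnit C U \<cdot> ?R) \<otimes>\<^sub>m Id C ?I = RUnit C U \<otimes>\<^sub>m Id C ?I"
    by (rule B.Iso_cancel_left[OF Braid_Iso, rotated -1]) simp_all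
qed simp_all

text \<open>The same argument with the second hexagon on \<open>1, 1, W\<close>, this time cancelling an isomorphism on the
  right.\<close>

lemma RUnit_Braid:
  assumes [simp]: "W \<in> Obj C"
  shows "RUnit C W \<cdot> Braid C (Unit C) W = LUnit C W"
proof (rule tensor_Unit_faithful)
  let ?I = "Unit C"
  let ?R = "Braid C ?I W"
  \<comment> \<open>The right-hand side of the hexagon without its last factor.\<close>
  let ?k = "\<alpha>' ?I W ?I \<cdot> (Id C ?I \<otimes>\<^sub>m ?R)"
  have k: "?k \<in> Iso C (?I \<otimes>\<^sub>o (?I \<otimes>\<^sub>o W)) ((?I \<otimes>\<^sub>o W) \<otimes>\<^sub>o ?I)"
    by (rule B.IsoI[of _ "(Id C ?I \<otimes>\<^sub>m Inv C ?R) \<cdot> Assoc C ?I W ?I"])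
      (simp_all add: comp_assoc interchange comp_eq_prefix[OF interchange]
        B.Inv_typing[OF Braid_Iso])
  show "(RUnit C W \<cdot> ?R) \<otimes>\<^sub>m Id C ?I = LUnit C W \<otimes>\<^sub>m Id C ?I"
  proof (rule B.Iso_cancel_right[OF k])
    have "((RUnit C W \<cdot> ?R) \<otimes>\<^sub>m Id C ?I) \<cdot> ?k
        = (RUnit C W \<otimes>\<^sub>m Id C ?I) \<cdot> (?R \<otimes>\<^sub>m Id C ?I) \<cdot> ?k"
      by (simp add: whisker_right comp_assoc)
    also have "\<dots> = (RUnit C W \<otimes>\<^sub>m Id C ?I) \<cdot> \<alpha>' W ?I ?I \<cdot> Braid C (?I \<otimes>\<^sub>o ?I) W \<cdot> \<alpha>' ?I ?I W"
      by (simp add: hexagon2)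
    also have "\<dots> = (Id C W \<otimes>\<^sub>m LUnit C ?I) \<cdot> Braid C (?I \<otimes>\<^sub>o ?I) W \<cdot> \<alpha>' ?I ?I W"
      by (simp add: comp_eq_prefix[OF triangle_inv])
    also have "\<dots> = ?R \<cdot> (LUnit C ?I \<otimes>\<^sub>m Id C W) \<cdot> \<alpha>' ?I ?I W"
      using comp_eq_prefix[OF Braid_nat[of "LUnit C ?I" "Id C W"]] by (simp add: comp_assoc)
    also have "\<dots> = LUnit C (W \<otimes>\<^sub>o ?I) \<cdot> (Id C ?I \<otimes>\<^sub>m ?R)"
      by (simp add: LUnit_tensor_inv LUnit_nat)
    also have "\<dots> = (LUnit C W \<otimes>\<^sub>m Id C ?I) \<cdot> ?k"
      by (simp add: comp_eq_prefix[OF LUnit_tensor_inv])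
    finally show "((RUnit C W \<cdot> ?R) \<otimes>\<^sub>m Id C ?I) \<cdot> ?k = (LUnit C W \<otimes>\<^sub>m Id C ?I) \<cdot> ?k" .
  qed simp_all
qed simp_all

text \<open>This is the map \<open>U \<otimes> (V \<otimes> X) \<rightarrow> V \<otimes> (U \<otimes> X)\<close> that braids \<open>U\<close> past \<open>V\<close> and fixes \<open>X\<close>.\<close>

definition exchange where
  "exchange U V X = Assoc C V U X \<cdot> (Braid C U V \<otimes>\<^sub>m Id C X) \<cdot> \<alpha>' U V X"

lemma exchange_typing [simp]:
  assumes "U \<in> Obj C" "V \<in> Obj C" "X \<in> Obj C"
  shows "exchange U V X \<in> Arr C" "Dom C (exchange U V X) = U \<otimes>\<^sub>o (V \<otimes>\<^sub>o X)"
    "Cod C (exchange U V X) = V \<otimes>\<^sub>o (U \<otimes>\<^sub>o X)"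
  using assms by (simp_all add: exchange_def)

lemma exchange_nat:
  assumes "f \<in> Arr C" "g \<in> Arr C" "h \<in> Arr C" "Cod C f = U" "Cod C g = V" "Cod C h = X"
  shows "exchange U V X \<cdot> (f \<otimes>\<^sub>m (g \<otimes>\<^sub>m h))
    = (g \<otimes>\<^sub>m (f \<otimes>\<^sub>m h)) \<cdot> exchange (Dom C f) (Dom C g) (Dom C h)"
proof -
  have o [simp]: "U \<in> Obj C" "V \<in> Obj C" "X \<in> Obj C"
    using assms B.Cod_Obj by blast+
  have "exchange U V X \<cdot> (f \<otimes>\<^sub>m (g \<otimes>\<^sub>m h))
    = Assoc C V U X \<cdot> (Braid C U V \<otimes>\<^sub>m Id C X) \<cdot> ((f \<otimes>\<^sub>m g) \<otimes>\<^sub>m h) \<cdot> \<alpha>' (Dom C f) (Dom C g) (Dom C h)"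
    using assms by (simp add: exchange_def comp_assoc assoc_inv_nat)
  also have "\<dots> = Assoc C V U X \<cdot> ((g \<otimes>\<^sub>m f) \<otimes>\<^sub>m h) \<cdot> (Braid C (Dom C f) (Dom C g) \<otimes>\<^sub>m Id C (Dom C h))
      \<cdot> \<alpha>' (Dom C f) (Dom C g) (Dom C h)"
    using assms by (simp add: comp_eq_prefix[OF interchange] interchange Braid_nat flip: comp_assoc)
  also have "\<dots> = (g \<otimes>\<^sub>m (f \<otimes>\<^sub>m h)) \<cdot> exchange (Dom C f) (Dom C g) (Dom C h)"
    using assms by (simp add: comp_eq_prefix[OF assoc_nat] exchange_def comp_assoc)
  finally show ?thesis .
qed

text \<open>By the triangle the unitor of \<open>X\<close> becomes the right unitor of \<open>V\<close>, the braiding turns that into the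
  left unitor of \<open>V\<close>, and \<open>LUnit_tensor\<close> absorbs the remaining associator.\<close>

lemma exchange_Unit_left:
  assumes [simp]: "V \<in> Obj C" "X \<in> Obj C"
  shows "(Id C V \<otimes>\<^sub>m LUnit C X) \<cdot> exchange (Unit C) V X = LUnit C (V \<otimes>\<^sub>o X)"
  by (simp add: exchange_def comp_eq_prefix[OF triangle] comp_eq_prefix[OF interchange]
      RUnit_Braid LUnit_tensor_inv)

lemma exchange_Unit_right:
  assumes [simp]: "U \<in> Obj C" "X \<in> Obj C"
  shows "LUnit C (U \<otimes>\<^sub>o X) \<cdot> exchange U (Unit C) X = Id C U \<otimes>\<^sub>m LUnit C X"
  by (simp add: exchange_def comp_eq_prefix[OF LUnit_tensor] comp_eq_prefix[OF interchange]
      LUnit_Braid triangle_inv)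

lemma Braid_tensor_right:
  assumes [simp]: "U \<in> Obj C" "V \<in> Obj C" "W \<in> Obj C"
  shows "Assoc C V W U \<cdot> Braid C U (V \<otimes>\<^sub>o W)
    = (Id C V \<otimes>\<^sub>m Braid C U W) \<cdot> Assoc C V U W \<cdot> (Braid C U V \<otimes>\<^sub>m Id C W) \<cdot> \<alpha>' U V W"
proof -
  have "Assoc C V W U \<cdot> Braid C U (V \<otimes>\<^sub>o W)
      = (Assoc C V W U \<cdot> Braid C U (V \<otimes>\<^sub>o W) \<cdot> Assoc C U V W) \<cdot> \<alpha>' U V W"
    by (simp add: comp_assoc)
  then show ?thesis
    by (simp add: hexagon1 comp_assoc)
qed

lemma Braid_tensor_left:
  assumes [simp]: "U \<in> Obj C" "V \<in> Obj C" "W \<in> Obj C"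
  shows "\<alpha>' W U V \<cdot> Braid C (U \<otimes>\<^sub>o V) W
    = (Braid C U W \<otimes>\<^sub>m Id C V) \<cdot> \<alpha>' U W V \<cdot> (Id C U \<otimes>\<^sub>m Braid C V W) \<cdot> Assoc C U V W"
proof -
  have "\<alpha>' W U V \<cdot> Braid C (U \<otimes>\<^sub>o V) W
      = (\<alpha>' W U V \<cdot> Braid C (U \<otimes>\<^sub>o V) W \<cdot> \<alpha>' U V W) \<cdot> Assoc C U V W"
    by (simp add: comp_assoc)
  then show ?thesis
    by (simp add: hexagon2 comp_assoc)
qed

text \<open>Moving \<open>U\<close> past \<open>V \<otimes> W\<close> is moving it past \<open>V\<close> and then past \<open>W\<close>. Both sides are brought to the
  common form \<open>?S\<close>: the left one by a pentagon, the hexagon and naturality, the right one by two pentagons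
  with inverses and naturality.\<close>

lemma exchange_tensor_right:
  assumes [simp]: "U \<in> Obj C" "V \<in> Obj C" "W \<in> Obj C" "X \<in> Obj C"
  shows "Assoc C V W (U \<otimes>\<^sub>o X) \<cdot> exchange U (V \<otimes>\<^sub>o W) X
    = (Id C V \<otimes>\<^sub>m exchange U W X) \<cdot> exchange U V (W \<otimes>\<^sub>o X) \<cdot> (Id C U \<otimes>\<^sub>m Assoc C V W X)"
proof -
  let ?a = "Assoc C" and ?R = "Braid C"
  let ?S = "(Id C V \<otimes>\<^sub>m ?a W U X) \<cdot> (Id C V \<otimes>\<^sub>m (?R U W \<otimes>\<^sub>m Id C X)) \<cdot> ?a V (U \<otimes>\<^sub>o W) X
    \<cdot> (?a V U W \<otimes>\<^sub>m Id C X) \<cdot> ((?R U V \<otimes>\<^sub>m Id C W) \<otimes>\<^sub>m Id C X)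
    \<cdot> (\<alpha>' U V W \<otimes>\<^sub>m Id C X) \<cdot> \<alpha>' U (V \<otimes>\<^sub>o W) X"
  have "?a V W (U \<otimes>\<^sub>o X) \<cdot> exchange U (V \<otimes>\<^sub>o W) X
    = (?a V W (U \<otimes>\<^sub>o X) \<cdot> ?a (V \<otimes>\<^sub>o W) U X) \<cdot> (?R U (V \<otimes>\<^sub>o W) \<otimes>\<^sub>m Id C X) \<cdot> \<alpha>' U (V \<otimes>\<^sub>o W) X"
    by (simp add: exchange_def comp_assoc)
  also have "\<dots> = (Id C V \<otimes>\<^sub>m ?a W U X) \<cdot> ?a V (W \<otimes>\<^sub>o U) X
    \<cdot> ((?a V W U \<cdot> ?R U (V \<otimes>\<^sub>o W)) \<otimes>\<^sub>m Id C X) \<cdot> \<alpha>' U (V \<otimes>\<^sub>o W) X"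
    by (simp add: pentagon comp_assoc whisker_right)
  also have "\<dots> = ?S"
    by (simp add: Braid_tensor_right whisker_right comp_assoc comp_eq_prefix[OF assoc_nat])
  finally have l: "?a V W (U \<otimes>\<^sub>o X) \<cdot> exchange U (V \<otimes>\<^sub>o W) X = ?S" .
  have "(Id C V \<otimes>\<^sub>m exchange U W X) \<cdot> exchange U V (W \<otimes>\<^sub>o X) \<cdot> (Id C U \<otimes>\<^sub>m ?a V W X)
    = (Id C V \<otimes>\<^sub>m ?a W U X) \<cdot> (Id C V \<otimes>\<^sub>m (?R U W \<otimes>\<^sub>m Id C X))
      \<cdot> ((Id C V \<otimes>\<^sub>m \<alpha>' U W X) \<cdot> ?a V U (W \<otimes>\<^sub>o X)) \<cdot> (?R U V \<otimes>\<^sub>m Id C (W \<otimes>\<^sub>o X))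
      \<cdot> \<alpha>' U V (W \<otimes>\<^sub>o X) \<cdot> (Id C U \<otimes>\<^sub>m ?a V W X)"
    by (simp add: exchange_def whisker_left comp_assoc)
  also have "\<dots> = (Id C V \<otimes>\<^sub>m ?a W U X) \<cdot> (Id C V \<otimes>\<^sub>m (?R U W \<otimes>\<^sub>m Id C X))
      \<cdot> ?a V (U \<otimes>\<^sub>o W) X \<cdot> (?a V U W \<otimes>\<^sub>m Id C X)
      \<cdot> (\<alpha>' (V \<otimes>\<^sub>o U) W X \<cdot> (?R U V \<otimes>\<^sub>m (Id C W \<otimes>\<^sub>m Id C X)))
      \<cdot> \<alpha>' U V (W \<otimes>\<^sub>o X) \<cdot> (Id C U \<otimes>\<^sub>m ?a V W X)"
    by (subst pentagon_assoc_right) (simp_all add: comp_assoc)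
  also have "\<dots> = (Id C V \<otimes>\<^sub>m ?a W U X) \<cdot> (Id C V \<otimes>\<^sub>m (?R U W \<otimes>\<^sub>m Id C X))
      \<cdot> ?a V (U \<otimes>\<^sub>o W) X \<cdot> (?a V U W \<otimes>\<^sub>m Id C X) \<cdot> ((?R U V \<otimes>\<^sub>m Id C W) \<otimes>\<^sub>m Id C X)
      \<cdot> (\<alpha>' (U \<otimes>\<^sub>o V) W X \<cdot> \<alpha>' U V (W \<otimes>\<^sub>o X)) \<cdot> (Id C U \<otimes>\<^sub>m ?a V W X)"
    by (subst assoc_inv_nat) (simp_all add: comp_assoc)
  also have "\<dots> = ?S"
    by (subst pentagon_inv) (simp_all add: comp_assoc)
  finally show ?thesis
    using l by simp
qed

text \<open>Moving \<open>U \<otimes> U'\<close> past \<open>V\<close> is moving \<open>U'\<close> past it and then \<open>U\<close>. The braiding of \<open>U \<otimes> U'\<close> is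
  expanded by the hexagon, and three instances of the pentagon, separated by naturality of the associator,
  transport the factors to the other side.\<close>

lemma exchange_tensor_left:
  assumes [simp]: "U \<in> Obj C" "U' \<in> Obj C" "V \<in> Obj C" "X \<in> Obj C"
  shows "(Id C V \<otimes>\<^sub>m Assoc C U U' X) \<cdot> exchange (U \<otimes>\<^sub>o U') V X
    = exchange U V (U' \<otimes>\<^sub>o X) \<cdot> (Id C U \<otimes>\<^sub>m exchange U' V X) \<cdot> Assoc C U U' (V \<otimes>\<^sub>o X)"
proof -
  let ?a = "Assoc C" and ?R = "Braid C"
  have R: "?R (U \<otimes>\<^sub>o U') V
    = ?a V U U' \<cdot> (?R U V \<otimes>\<^sub>m Id C U') \<cdot> \<alpha>' U V U' \<cdot> (Id C U \<otimes>\<^sub>m ?R U' V) \<cdot> ?a U U' V"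
    by (simp flip: Braid_tensor_left)
  have "(Id C V \<otimes>\<^sub>m ?a U U' X) \<cdot> exchange (U \<otimes>\<^sub>o U') V X
    = ((Id C V \<otimes>\<^sub>m ?a U U' X) \<cdot> ?a V (U \<otimes>\<^sub>o U') X \<cdot> (?a V U U' \<otimes>\<^sub>m Id C X))
      \<cdot> ((?R U V \<otimes>\<^sub>m Id C U') \<otimes>\<^sub>m Id C X) \<cdot> (\<alpha>' U V U' \<otimes>\<^sub>m Id C X)
      \<cdot> ((Id C U \<otimes>\<^sub>m ?R U' V) \<otimes>\<^sub>m Id C X) \<cdot> (?a U U' V \<otimes>\<^sub>m Id C X) \<cdot> \<alpha>' (U \<otimes>\<^sub>o U') V X"
    by (simp add: exchange_def R whisker_right comp_assoc)
  also have "\<dots> = ?a V U (U' \<otimes>\<^sub>o X) \<cdot> (?a (V \<otimes>\<^sub>o U) U' X \<cdot> ((?R U V \<otimes>\<^sub>m Id C U') \<otimes>\<^sub>m Id C X))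
      \<cdot> (\<alpha>' U V U' \<otimes>\<^sub>m Id C X)
      \<cdot> ((Id C U \<otimes>\<^sub>m ?R U' V) \<otimes>\<^sub>m Id C X) \<cdot> (?a U U' V \<otimes>\<^sub>m Id C X) \<cdot> \<alpha>' (U \<otimes>\<^sub>o U') V X"
    by (subst pentagon[symmetric]) (simp_all add: comp_assoc)
  also have "\<dots> = ?a V U (U' \<otimes>\<^sub>o X) \<cdot> (?R U V \<otimes>\<^sub>m Id C (U' \<otimes>\<^sub>o X))
      \<cdot> (?a (U \<otimes>\<^sub>o V) U' X \<cdot> (\<alpha>' U V U' \<otimes>\<^sub>m Id C X))
      \<cdot> ((Id C U \<otimes>\<^sub>m ?R U' V) \<otimes>\<^sub>m Id C X) \<cdot> (?a U U' V \<otimes>\<^sub>m Id C X) \<cdot> \<alpha>' (U \<otimes>\<^sub>o U') V X"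
    by (subst assoc_nat) (simp_all add: comp_assoc)
  also have "\<dots> = exchange U V (U' \<otimes>\<^sub>o X) \<cdot> (Id C U \<otimes>\<^sub>m ?a V U' X)
      \<cdot> (?a U (V \<otimes>\<^sub>o U') X \<cdot> ((Id C U \<otimes>\<^sub>m ?R U' V) \<otimes>\<^sub>m Id C X))
      \<cdot> (?a U U' V \<otimes>\<^sub>m Id C X) \<cdot> \<alpha>' (U \<otimes>\<^sub>o U') V X"
    by (subst pentagon_assoc_left) (simp_all add: comp_assoc exchange_def)
  also have "\<dots> = exchange U V (U' \<otimes>\<^sub>o X) \<cdot> (Id C U \<otimes>\<^sub>m ?a V U' X)
      \<cdot> (Id C U \<otimes>\<^sub>m (?R U' V \<otimes>\<^sub>m Id C X))
      \<cdot> (?a U (U' \<otimes>\<^sub>o V) X \<cdot> (?a U U' V \<otimes>\<^sub>m Id C X) \<cdot> \<alpha>' (U \<otimes>\<^sub>o U') V X)"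
    by (subst assoc_nat) (simp_all add: comp_assoc)
  also have "\<dots> = exchange U V (U' \<otimes>\<^sub>o X) \<cdot> (Id C U \<otimes>\<^sub>m exchange U' V X) \<cdot> ?a U U' (V \<otimes>\<^sub>o X)"
    by (subst pentagon_assoc_right[symmetric])
      (simp_all add: comp_assoc exchange_def whisker_left)
  finally show ?thesis .
qed

end

section \<open>Additive structure of Hom sets\<close>

text \<open>Composition with a fixed morphism, tensoring with a fixed object and the forgetful map from the Hom
  sets of \<open>Rep A\<close> to those of \<open>C\<close> are all additive maps of abelian groups. The following two lemmas
  serve all of them.\<close>

lemma additive_map_zero:
  assumes "abelian_group G" "abelian_group H"
    and "\<And>x. x \<in> carrier G \<Longrightarrow> h x \<in> carrier H"
    and "\<And>x y. \<lbrakk>x \<in> carrier G; y \<in> carrier G\<rbrakk> \<Longrightarrow> h (x \<oplus>\<^bsub>G\<^esub> y) = h x \<oplus>\<^bsub>H\<^esub> h y"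
  shows "h \<zero>\<^bsub>G\<^esub> = \<zero>\<^bsub>H\<^esub>"
proof -
  interpret G: abelian_group G by fact
  interpret H: abelian_group H by fact
  have "h \<zero>\<^bsub>G\<^esub> \<oplus>\<^bsub>H\<^esub> h \<zero>\<^bsub>G\<^esub> = h \<zero>\<^bsub>G\<^esub>"
    using assms(4)[of "\<zero>\<^bsub>G\<^esub>" "\<zero>\<^bsub>G\<^esub>"] by simp
  then show ?thesis
    using assms(3)[of "\<zero>\<^bsub>G\<^esub>"] by simp
qed

lemma additive_map_finsum:
  fixes F :: "nat \<Rightarrow> _"
  assumes "abelian_group G" "abelian_group H"
    and "\<And>x. x \<in> carrier G \<Longrightarrow> h x \<in> carrier H"
    and "\<And>x y. \<lbrakk>x \<in> carrier G; y \<in> carrier G\<rbrakk> \<Longrightarrow> h (x \<oplus>\<^bsub>G\<^esub> y) = h x \<oplus>\<^bsub>H\<^esub> h y"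
    and "\<And>j. j < n \<Longrightarrow> F j \<in> carrier G"
  shows "h (finsum G F {..<n}) = finsum H (\<lambda>j. h (F j)) {..<n}"
proof -
  interpret G: abelian_group G by fact
  interpret H: abelian_group H by fact
  from assms(5) show ?thesis
  proof (induction n)
    case 0
    show ?case
      using additive_map_zero[of G H h] assms(1-4) by simp
  next
    case (Suc n)
    have F: "F \<in> {..<n} \<rightarrow> carrier G" "F n \<in> carrier G"
      "(\<lambda>j. h (F j)) \<in> {..<n} \<rightarrow> carrier H" "h (F n) \<in> carrier H"
      using Suc.prems assms(3) by auto
    have "h (finsum G F {..<Suc n}) = h (F n) \<oplus>\<^bsub>H\<^esub> h (finsum G F {..<n})"
      using F by (simp add: lessThan_Suc assms(4))
    also have "h (finsum G F {..<n}) = finsum H (\<lambda>j. h (F j)) {..<n}"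
      using Suc.prems by (intro Suc.IH) simp
    finally show ?case
      using F by (simp add: lessThan_Suc)
  qed
qed

lemma hom_space_simps [simp]:
  "carrier (hom_space C X Y) = Hom C X Y"
  "\<zero>\<^bsub>hom_space C X Y\<^esub> = Zero C X Y"
  "f \<oplus>\<^bsub>hom_space C X Y\<^esub> g = Add C f g"
  "c \<odot>\<^bsub>hom_space C X Y\<^esub> f = Smult C c f"
  by (simp_all add: hom_space_def)

context linear_category
begin

lemma hom_space_abelian_group:
  assumes "X \<in> Obj C" "Y \<in> Obj C"
  shows "abelian_group (hom_space C X Y)"
proof -
  interpret vectorspace complex_field "hom_space C X Y"
    by (rule Hom_vectorspace) fact+
  show ?thesis
    by unfold_locales
qed

lemma Add_Hom: "\<lbrakk>f \<in> Hom C X Y; g \<in> Hom C X Y\<rbrakk> \<Longrightarrow> Add C f g \<in> Hom C X Y"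
  using abelian_groupE(1)[OF hom_space_abelian_group[of X Y]] Dom_Obj[of f] Cod_Obj[of f]
  by (auto simp: Hom_iff)

lemma Add_typing [simp]:
  assumes "f \<in> Arr C" "g \<in> Arr C" "Dom C f = Dom C g" "Cod C f = Cod C g"
  shows "Add C f g \<in> Arr C" "Dom C (Add C f g) = Dom C g" "Cod C (Add C f g) = Cod C g"
  using Add_Hom[of f "Dom C g" "Cod C g" g] assms by (auto simp: Hom_iff)

lemma Zero_typing [simp]:
  assumes "X \<in> Obj C" "Y \<in> Obj C"
  shows "Zero C X Y \<in> Arr C" "Dom C (Zero C X Y) = X" "Cod C (Zero C X Y) = Y"
  using abelian_groupE(2)[OF hom_space_abelian_group[OF assms]] by (auto simp: Hom_iff)

lemma Smult_typing [simp]: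
  assumes "f \<in> Arr C"
  shows "Smult C c f \<in> Arr C" "Dom C (Smult C c f) = Dom C f" "Cod C (Smult C c f) = Cod C f"
proof -
  interpret vectorspace complex_field "hom_space C (Dom C f) (Cod C f)"
    using Hom_vectorspace Dom_Obj Cod_Obj assms by blast
  have "f \<in> carrier (hom_space C (Dom C f) (Cod C f))"
    using assms by (simp add: Hom_iff)
  then show "Smult C c f \<in> Arr C" "Dom C (Smult C c f) = Dom C f" "Cod C (Smult C c f) = Cod C f"
    using smult_closed[of c f] by (auto simp: Hom_iff)
qed

lemma Zero_comp:
  assumes f: "f \<in> Arr C" and "Cod C f = Y" "Z \<in> Obj C"
  shows "Zero C Y Z \<cdot> f = Zero C (Dom C f) Z"
proof -
  have "(\<lambda>g. g \<cdot> f) \<zero>\<^bsub>hom_space C Y Z\<^esub> = \<zero>\<^bsub>hom_space C (Dom C f) Z\<^esub>"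
    by (rule additive_map_zero)
      (use assms in \<open>auto simp: Hom_iff intro!: hom_space_abelian_group Comp_Add_left\<close>)
  then show ?thesis
    by simp
qed

lemma comp_Zero:
  assumes f: "g \<in> Arr C" and "Dom C g = Y" "X \<in> Obj C"
  shows "g \<cdot> Zero C X Y = Zero C X (Cod C g)"
proof -
  have "(\<lambda>f. g \<cdot> f) \<zero>\<^bsub>hom_space C X Y\<^esub> = \<zero>\<^bsub>hom_space C X (Cod C g)\<^esub>"
    by (rule additive_map_zero)
      (use assms in \<open>auto simp: Hom_iff intro!: hom_space_abelian_group Comp_Add_right\<close>)
  then show ?thesis
    by simp
qed

lemma finsum_typing [simp]:
  assumes "X \<in> Obj C" "Y \<in> Obj C" "\<And>j. j < (n :: nat) \<Longrightarrow> F j \<in> Hom C X Y"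
  shows "finsum (hom_space C X Y) F {..<n} \<in> Arr C"
    "Dom C (finsum (hom_space C X Y) F {..<n}) = X"
    "Cod C (finsum (hom_space C X Y) F {..<n}) = Y"
proof -
  interpret abelian_group "hom_space C X Y"
    using assms by (simp add: hom_space_abelian_group)
  show "finsum (hom_space C X Y) F {..<n} \<in> Arr C"
    "Dom C (finsum (hom_space C X Y) F {..<n}) = X"
    "Cod C (finsum (hom_space C X Y) F {..<n}) = Y"
    using finsum_closed[of F "{..<n}"] assms by (auto simp: Pi_def Hom_iff)
qed

lemma finsum_comp:
  assumes "f \<in> Hom C X Y" "Z \<in> Obj C" "\<And>j. j < (n :: nat) \<Longrightarrow> F j \<in> Hom C Y Z"
  shows "finsum (hom_space C Y Z) F {..<n} \<cdot> f = finsum (hom_space C X Z) (\<lambda>j. F j \<cdot> f) {..<n}"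
proof (rule additive_map_finsum[where h = "\<lambda>g. g \<cdot> f"])
  show "abelian_group (hom_space C Y Z)" "abelian_group (hom_space C X Z)"
    using assms Dom_Obj Cod_Obj by (auto simp: Hom_iff intro!: hom_space_abelian_group)
qed (use assms in \<open>auto simp: Hom_iff Comp_Add_left\<close>)

lemma comp_finsum:
  assumes "g \<in> Hom C Y Z" "X \<in> Obj C" "\<And>j. j < (n :: nat) \<Longrightarrow> F j \<in> Hom C X Y"
  shows "g \<cdot> finsum (hom_space C X Y) F {..<n} = finsum (hom_space C X Z) (\<lambda>j. g \<cdot> F j) {..<n}"
proof (rule additive_map_finsum[where h = "\<lambda>f. g \<cdot> f"])
  show "abelian_group (hom_space C X Y)" "abelian_group (hom_space C X Z)"
    using assms Dom_Obj Cod_Obj by (auto simp: Hom_iff intro!: hom_space_abelian_group)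
qed (use assms in \<open>auto simp: Hom_iff Comp_Add_right\<close>)

end

lemma (in linear_category) finsum_single:
  assumes "X \<in> Obj C" "Y \<in> Obj C" "k < (n :: nat)" "F k \<in> Hom C X Y"
    and "\<And>j. \<lbrakk>j < n; j \<noteq> k\<rbrakk> \<Longrightarrow> F j = Zero C X Y"
  shows "finsum (hom_space C X Y) F {..<n} = F k"
proof -
  interpret H: abelian_group "hom_space C X Y"
    using assms by (simp add: hom_space_abelian_group)
  have F: "F \<in> {..<n} \<rightarrow> carrier (hom_space C X Y)"
  proof
    fix j assume "j \<in> {..<n}"
    then show "F j \<in> carrier (hom_space C X Y)"
      using assms H.zero_closed by (cases "j = k") auto
  qed
  have "finsum (hom_space C X Y) F {..<n}
      = finsum (hom_space C X Y) (\<lambda>j. if k = j then F j else \<zero>\<^bsub>hom_space C X Y\<^esub>) {..<n}"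
    using F assms H.zero_closed by (intro H.finsum_cong') auto
  then show ?thesis
    using H.finsum_singleton[of k "{..<n}" F] F assms(3) by simp
qed


section \<open>The linear category of modules\<close>

locale algebra_modules = tensor_category C + braided_category C + C_algebra C A
  for C :: "('o, 'm, 'z) bal_cat_scheme" (structure) and A :: "('o, 'm, 'y) cat_algebra_scheme"
begin

abbreviation "\<A> \<equiv> AObj A"
abbreviation "\<R> \<equiv> Rep C A"

lemma algebra_typing [simp]:
  "\<A> \<in> Obj C" "AMult A \<in> Arr C" "Dom C (AMult A) = \<A> \<otimes>\<^sub>o \<A>" "Cod C (AMult A) = \<A>"
  "AUnit A \<in> Arr C" "Dom C (AUnit A) = Unit C" "Cod C (AUnit A) = \<A>"
  using AObj_Obj AMult_Hom AUnit_Hom by (auto simp: Hom_iff)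

lemma Rep_simps [simp]:
  "Obj \<R> = Rep_Obj C A"
  "Dom \<R> (X, f, Y) = X" "Cod \<R> (X, f, Y) = Y"
  "Id \<R> X = (X, Id C (fst X), X)"
  "(Y', g, Z) \<cdot>\<^bsub>\<R>\<^esub> (X, f, Y) = (X, g \<cdot> f, Z)"
  "Zero \<R> X Y = (X, Zero C (fst X) (fst Y), Y)"
  "Add \<R> (X, f, Y) (X', g, Y') = (X, Add C f g, Y)"
  "Smult \<R> c (X, f, Y) = (X, Smult C c f, Y)"
  by (simp_all add: Rep_def)

lemma Rep_Arr_iff:
  "(X, f, Y) \<in> Arr \<R> \<longleftrightarrow> X \<in> Rep_Obj C A \<and> Y \<in> Rep_Obj C A \<and> f \<in> Hom C (fst X) (fst Y) \<and>
     f \<cdot> snd X = snd Y \<cdot> (Id C \<A> \<otimes>\<^sub>m f)"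
  by (simp add: Rep_def)

lemma Rep_Hom_iff:
  "a \<in> Hom \<R> X Y \<longleftrightarrow> (\<exists>f. a = (X, f, Y) \<and> X \<in> Rep_Obj C A \<and> Y \<in> Rep_Obj C A \<and>
     f \<in> Arr C \<and> Dom C f = fst X \<and> Cod C f = fst Y \<and> f \<cdot> snd X = snd Y \<cdot> (Id C \<A> \<otimes>\<^sub>m f))"
  by (cases a) (auto simp: Hom_def Rep_Arr_iff)

lemma module_typing [simp]:
  assumes "X \<in> Rep_Obj C A"
  shows "fst X \<in> Obj C" "snd X \<in> Arr C" "Dom C (snd X) = \<A> \<otimes>\<^sub>o fst X" "Cod C (snd X) = fst X"
  using assms by (auto simp: Rep_Obj_def Hom_iff)

lemma module_assoc:
  "X \<in> Rep_Obj C A \<Longrightarrow> snd X \<cdot> (AMult A \<otimes>\<^sub>m Id C (fst X))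
    = snd X \<cdot> (Id C \<A> \<otimes>\<^sub>m snd X) \<cdot> Assoc C \<A> \<A> (fst X)"
  and module_unit: "X \<in> Rep_Obj C A \<Longrightarrow> snd X \<cdot> (AUnit A \<otimes>\<^sub>m Id C (fst X)) = LUnit C (fst X)"
  by (auto simp: Rep_Obj_def)

lemma module_map_comp:
  assumes [simp]: "X \<in> Rep_Obj C A" "Y \<in> Rep_Obj C A" "Z \<in> Rep_Obj C A"
    and f: "f \<in> Arr C" "Dom C f = fst X" "Cod C f = fst Y" "f \<cdot> snd X = snd Y \<cdot> (Id C \<A> \<otimes>\<^sub>m f)"
    and g: "g \<in> Arr C" "Dom C g = fst Y" "Cod C g = fst Z" "g \<cdot> snd Y = snd Z \<cdot> (Id C \<A> \<otimes>\<^sub>m g)"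
  shows "(g \<cdot> f) \<cdot> snd X = snd Z \<cdot> (Id C \<A> \<otimes>\<^sub>m (g \<cdot> f))"
  using f g by (simp add: whisker_left comp_assoc comp_eq_prefix[OF g(4)])

lemma category_Rep: "category \<R>"
proof
  fix f assume "f \<in> Arr \<R>"
  then show "Dom \<R> f \<in> Obj \<R>" "Cod \<R> f \<in> Obj \<R>"
    by (cases f; simp add: Rep_Arr_iff)+
next
  fix X Y Z f g
  assume "f \<in> Hom \<R> X Y" "g \<in> Hom \<R> Y Z"
  then show "g \<cdot>\<^bsub>\<R>\<^esub> f \<in> Hom \<R> X Z"
    by (auto simp: Rep_Hom_iff intro: module_map_comp)
qed (auto simp: Rep_Hom_iff comp_assoc)

lemma Id_tensor_Add:
  "\<lbrakk>X \<in> Obj C; f \<in> Arr C; g \<in> Arr C; Dom C f = Dom C g; Cod C f = Cod C g\<rbrakk>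
    \<Longrightarrow> Id C X \<otimes>\<^sub>m Add C f g = Add C (Id C X \<otimes>\<^sub>m f) (Id C X \<otimes>\<^sub>m g)"
  using Fm_Add_right[of "Id C X" X X f "Dom C g" "Cod C g" g] by (auto simp: Hom_iff)

lemma Id_tensor_Zero:
  assumes "X \<in> Obj C" "Y \<in> Obj C" "Z \<in> Obj C"
  shows "Id C X \<otimes>\<^sub>m Zero C Y Z = Zero C (X \<otimes>\<^sub>o Y) (X \<otimes>\<^sub>o Z)"
proof -
  have "(\<lambda>f. Id C X \<otimes>\<^sub>m f) \<zero>\<^bsub>hom_space C Y Z\<^esub> = \<zero>\<^bsub>hom_space C (X \<otimes>\<^sub>o Y) (X \<otimes>\<^sub>o Z)\<^esub>"
    by (rule additive_map_zero)
      (use assms in \<open>auto simp: Hom_iff Id_tensor_Add intro!: hom_space_abelian_group\<close>)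
  then show ?thesis
    by simp
qed

lemma Id_tensor_finsum:
  assumes "X \<in> Obj C" "Y \<in> Obj C" "Z \<in> Obj C" "\<And>j. j < (n :: nat) \<Longrightarrow> F j \<in> Hom C Y Z"
  shows "Id C X \<otimes>\<^sub>m finsum (hom_space C Y Z) F {..<n}
    = finsum (hom_space C (X \<otimes>\<^sub>o Y) (X \<otimes>\<^sub>o Z)) (\<lambda>j. Id C X \<otimes>\<^sub>m F j) {..<n}"
  by (rule additive_map_finsum) (use assms in \<open>auto simp: Hom_iff Id_tensor_Add
      intro!: hom_space_abelian_group\<close>)

lemma Add_module_map:
  assumes "X \<in> Rep_Obj C A" "Y \<in> Rep_Obj C A"
    and "f \<in> Arr C" "Dom C f = fst X" "Cod C f = fst Y" "f \<cdot> snd X = snd Y \<cdot> (Id C \<A> \<otimes>\<^sub>m f)"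
    and "g \<in> Arr C" "Dom C g = fst X" "Cod C g = fst Y" "g \<cdot> snd X = snd Y \<cdot> (Id C \<A> \<otimes>\<^sub>m g)"
  shows "Add C f g \<cdot> snd X = snd Y \<cdot> (Id C \<A> \<otimes>\<^sub>m Add C f g)"
proof -
  have "Add C f g \<cdot> snd X = Add C (f \<cdot> snd X) (g \<cdot> snd X)"
    by (rule Comp_Add_left) (use assms in \<open>auto simp: Hom_iff\<close>)
  also have "\<dots> = snd Y \<cdot> Add C (Id C \<A> \<otimes>\<^sub>m f) (Id C \<A> \<otimes>\<^sub>m g)"
    unfolding assms(6,10)
    by (rule Comp_Add_right[symmetric]) (use assms in \<open>auto simp: Hom_iff\<close>)
  finally show ?thesis
    using assms by (simp add: Id_tensor_Add)
qed

lemma Smult_module_map: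
  assumes "X \<in> Rep_Obj C A" "Y \<in> Rep_Obj C A"
    and "f \<in> Arr C" "Dom C f = fst X" "Cod C f = fst Y" "f \<cdot> snd X = snd Y \<cdot> (Id C \<A> \<otimes>\<^sub>m f)"
  shows "Smult C c f \<cdot> snd X = snd Y \<cdot> (Id C \<A> \<otimes>\<^sub>m Smult C c f)"
proof -
  have "Smult C c f \<cdot> snd X = Smult C c (f \<cdot> snd X)"
    by (rule Comp_Smult_left) (use assms in \<open>auto simp: Hom_iff\<close>)
  also have "\<dots> = snd Y \<cdot> Smult C c (Id C \<A> \<otimes>\<^sub>m f)"
    unfolding assms(6)
    by (rule Comp_Smult_right[symmetric]) (use assms in \<open>auto simp: Hom_iff\<close>)
  also have "Smult C c (Id C \<A> \<otimes>\<^sub>m f) = Id C \<A> \<otimes>\<^sub>m Smult C c f"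
    by (rule Fm_Smult_right[symmetric]) (use assms in \<open>auto simp: Hom_iff\<close>)
  finally show ?thesis .
qed

lemma Zero_module_map:
  assumes "X \<in> Rep_Obj C A" "Y \<in> Rep_Obj C A"
  shows "Zero C (fst X) (fst Y) \<cdot> snd X = snd Y \<cdot> (Id C \<A> \<otimes>\<^sub>m Zero C (fst X) (fst Y))"
  using assms by (simp add: Id_tensor_Zero Zero_comp comp_Zero)

text \<open>Morphisms of modules form a subspace of the Hom space of the underlying objects, tagged with source and
  target; additive inverses are multiples by \<open>-1\<close>.\<close>

lemma Rep_hom_vectorspace:
  assumes [simp]: "X \<in> Rep_Obj C A" "Y \<in> Rep_Obj C A"
  shows "vectorspace complex_field (hom_space \<R> X Y)"
proof -
  let ?H = "hom_space C (fst X) (fst Y)" and ?M = "hom_space \<R> X Y"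
  interpret V: vectorspace complex_field ?H
    by (simp add: Hom_vectorspace)
  have M: "a \<in> carrier ?M \<longleftrightarrow> (\<exists>f. a = (X, f, Y) \<and> f \<in> carrier ?H \<and>
      f \<cdot> snd X = snd Y \<cdot> (Id C \<A> \<otimes>\<^sub>m f))" for a
    unfolding hom_space_simps Rep_Hom_iff by (simp add: Hom_iff)
  have add: "Add C f g \<in> carrier ?H \<and> Add C f g \<cdot> snd X = snd Y \<cdot> (Id C \<A> \<otimes>\<^sub>m Add C f g)"
    if "f \<in> carrier ?H" "g \<in> carrier ?H" "f \<cdot> snd X = snd Y \<cdot> (Id C \<A> \<otimes>\<^sub>m f)"
      "g \<cdot> snd X = snd Y \<cdot> (Id C \<A> \<otimes>\<^sub>m g)" for f g
    using that by (simp add: Hom_iff Add_module_map)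
  have smult: "Smult C c f \<in> carrier ?H \<and> Smult C c f \<cdot> snd X = snd Y \<cdot> (Id C \<A> \<otimes>\<^sub>m Smult C c f)"
    if "f \<in> carrier ?H" "f \<cdot> snd X = snd Y \<cdot> (Id C \<A> \<otimes>\<^sub>m f)" for c f
    using that by (simp add: Hom_iff Smult_module_map)
  have zero: "Zero C (fst X) (fst Y) \<in> carrier ?H"
    by (simp add: Hom_iff)
  have neg: "Add C (Smult C (-1) f) f = Zero C (fst X) (fst Y)" if "f \<in> carrier ?H" for f
    using V.smult_l_distr[of "-1" 1 f] V.smult_l_null[of f] V.smult_one[of f] that by simp
  have "abelian_group ?M"
  proof (rule abelian_groupI)
    fix a b c assume "a \<in> carrier ?M" "b \<in> carrier ?M" "c \<in> carrier ?M"
    then obtain f g h where f: "a = (X, f, Y)" "f \<in> carrier ?H" "f \<cdot> snd X = snd Y \<cdot> (Id C \<A> \<otimes>\<^sub>m f)"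
      and g: "b = (X, g, Y)" "g \<in> carrier ?H" "g \<cdot> snd X = snd Y \<cdot> (Id C \<A> \<otimes>\<^sub>m g)"
      and h: "c = (X, h, Y)" "h \<in> carrier ?H"
      unfolding M by auto
    show "a \<oplus>\<^bsub>?M\<^esub> b \<in> carrier ?M"
      unfolding M using f g add[of f g] by simp
    show "(a \<oplus>\<^bsub>?M\<^esub> b) \<oplus>\<^bsub>?M\<^esub> c = a \<oplus>\<^bsub>?M\<^esub> (b \<oplus>\<^bsub>?M\<^esub> c)"
      using f g h V.a_assoc[of f g h] by simp
    show "a \<oplus>\<^bsub>?M\<^esub> b = b \<oplus>\<^bsub>?M\<^esub> a"
      using f g V.a_comm[of f g] by simp
  next
    show "\<zero>\<^bsub>?M\<^esub> \<in> carrier ?M"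
      unfolding M using zero by (simp add: Zero_module_map)
  next
    fix a assume "a \<in> carrier ?M"
    then obtain f where f: "a = (X, f, Y)" "f \<in> carrier ?H" "f \<cdot> snd X = snd Y \<cdot> (Id C \<A> \<otimes>\<^sub>m f)"
      unfolding M by auto
    then show "\<zero>\<^bsub>?M\<^esub> \<oplus>\<^bsub>?M\<^esub> a = a"
      using V.l_zero[of f] by simp
    have "(X, Smult C (-1) f, Y) \<in> carrier ?M"
      unfolding M using smult[OF f(2,3)] by simp
    moreover have "(X, Smult C (-1) f, Y) \<oplus>\<^bsub>?M\<^esub> a = \<zero>\<^bsub>?M\<^esub>"
      using f neg by simp
    ultimately show "\<exists>b \<in> carrier ?M. b \<oplus>\<^bsub>?M\<^esub> a = \<zero>\<^bsub>?M\<^esub>"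
      by blast
  qed
  then have "module complex_field ?M"
  proof (rule moduleI[OF class_cring.cring_axioms])
    fix c d :: complex and a b assume "a \<in> carrier ?M" "b \<in> carrier ?M"
    then obtain f g where f: "a = (X, f, Y)" "f \<in> carrier ?H" "f \<cdot> snd X = snd Y \<cdot> (Id C \<A> \<otimes>\<^sub>m f)"
      and g: "b = (X, g, Y)" "g \<in> carrier ?H"
      unfolding M by auto
    show "c \<odot>\<^bsub>?M\<^esub> a \<in> carrier ?M"
      unfolding M using f smult[OF f(2,3)] by simp
    show "(c \<oplus>\<^bsub>complex_field\<^esub> d) \<odot>\<^bsub>?M\<^esub> a = (c \<odot>\<^bsub>?M\<^esub> a) \<oplus>\<^bsub>?M\<^esub> (d \<odot>\<^bsub>?M\<^esub> a)"
      using f V.smult_l_distr[of c d f] by simp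
    show "c \<odot>\<^bsub>?M\<^esub> (a \<oplus>\<^bsub>?M\<^esub> b) = (c \<odot>\<^bsub>?M\<^esub> a) \<oplus>\<^bsub>?M\<^esub> (c \<odot>\<^bsub>?M\<^esub> b)"
      using f g V.smult_r_distr[of c f g] by simp
    show "(c \<otimes>\<^bsub>complex_field\<^esub> d) \<odot>\<^bsub>?M\<^esub> a = c \<odot>\<^bsub>?M\<^esub> (d \<odot>\<^bsub>?M\<^esub> a)"
      using f V.smult_assoc1[of c d f] by simp
    show "\<one>\<^bsub>complex_field\<^esub> \<odot>\<^bsub>?M\<^esub> a = a"
      using f V.smult_one[of f] by simp
  qed
  then show ?thesis
    by (intro vectorspace.intro class_field.field_axioms)
qed

lemma Rep_HomE:
  assumes "a \<in> Hom \<R> X Y"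
  obtains f where "a = (X, f, Y)" "f \<in> Hom C (fst X) (fst Y)"
  using assms unfolding Rep_Hom_iff by (auto simp: Hom_def)

lemma linear_category_Rep: "linear_category \<R>"
proof (intro linear_category.intro linear_category_axioms.intro category_Rep)
  fix X Y Z f f' g g' and c :: complex
  show "vectorspace complex_field (hom_space \<R> X Y)" if "X \<in> Obj \<R>" "Y \<in> Obj \<R>"
    using that by (simp add: Rep_hom_vectorspace)
  show "Add \<R> g g' \<cdot>\<^bsub>\<R>\<^esub> f = Add \<R> (g \<cdot>\<^bsub>\<R>\<^esub> f) (g' \<cdot>\<^bsub>\<R>\<^esub> f)"
    if "f \<in> Hom \<R> X Y" "g \<in> Hom \<R> Y Z" "g' \<in> Hom \<R> Y Z"
    using that by (elim Rep_HomE) (simp add: Comp_Add_left)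
  show "g \<cdot>\<^bsub>\<R>\<^esub> Add \<R> f f' = Add \<R> (g \<cdot>\<^bsub>\<R>\<^esub> f) (g \<cdot>\<^bsub>\<R>\<^esub> f')"
    if "f \<in> Hom \<R> X Y" "f' \<in> Hom \<R> X Y" "g \<in> Hom \<R> Y Z"
    using that by (elim Rep_HomE) (simp add: Comp_Add_right)
  show "Smult \<R> c g \<cdot>\<^bsub>\<R>\<^esub> f = Smult \<R> c (g \<cdot>\<^bsub>\<R>\<^esub> f)" if "f \<in> Hom \<R> X Y" "g \<in> Hom \<R> Y Z"
    using that by (elim Rep_HomE) (simp add: Comp_Smult_left)
  show "g \<cdot>\<^bsub>\<R>\<^esub> Smult \<R> c f = Smult \<R> c (g \<cdot>\<^bsub>\<R>\<^esub> f)" if "f \<in> Hom \<R> X Y" "g \<in> Hom \<R> Y Z"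
    using that by (elim Rep_HomE) (simp add: Comp_Smult_right)
qed

text \<open>The inverse of an invertible module map is a module map, so isomorphisms may be recognised in \<open>C\<close>.\<close>

lemma Rep_IsoI:
  assumes "f \<in> Iso C (fst X) (fst Y)" "X \<in> Rep_Obj C A" "Y \<in> Rep_Obj C A"
    "f \<cdot> snd X = snd Y \<cdot> (Id C \<A> \<otimes>\<^sub>m f)"
  shows "(X, f, Y) \<in> Iso \<R> X Y"
proof -
  interpret R: category \<R> by (rule category_Rep)
  let ?g = "Inv C f"
  note t [simp] = B.Iso_Arr[OF assms(1)] B.Inv_typing[OF assms(1)] assms(2,3)
  have "?g \<cdot> snd Y = ?g \<cdot> (snd Y \<cdot> (Id C \<A> \<otimes>\<^sub>m f)) \<cdot> (Id C \<A> \<otimes>\<^sub>m ?g)"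
    by (simp add: comp_assoc interchange)
  also have "\<dots> = snd X \<cdot> (Id C \<A> \<otimes>\<^sub>m ?g)"
    unfolding assms(4)[symmetric] by (simp add: comp_assoc B.Inv_cancel[OF assms(1)])
  finally have g: "?g \<cdot> snd Y = snd X \<cdot> (Id C \<A> \<otimes>\<^sub>m ?g)" .
  show ?thesis
    by (rule R.IsoI[of _ "(Y, ?g, X)"]) (use assms(4) g in \<open>simp_all add: Rep_Arr_iff Hom_iff\<close>)
qed


section \<open>Direct sums of modules\<close>

text \<open>Since \<open>id\<^sub>B \<otimes> -\<close> is additive, \<open>id = \<Sum>\<^sub>k (id\<^sub>B \<otimes> i\<^sub>k) \<cdot> (id\<^sub>B \<otimes> p\<^sub>k)\<close> on \<open>B \<otimes> X\<close>, so a morphism out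
  of \<open>B \<otimes> X\<close> is determined by its restrictions to the summands \<open>B \<otimes> V\<^sub>k\<close>.\<close>

lemma tensor_direct_sum_ext:
  assumes B: "B \<in> Obj C" and X: "X \<in> Obj C"
    and i: "\<And>j. j < n \<Longrightarrow> i j \<in> Hom C (V j) X" and p: "\<And>j. j < n \<Longrightarrow> p j \<in> Hom C X (V j)"
    and sum: "finsum (hom_space C X X) (\<lambda>j. i j \<cdot> p j) {..<(n :: nat)} = Id C X"
    and f: "f \<in> Arr C" "Dom C f = B \<otimes>\<^sub>o X" and g: "g \<in> Arr C" "Dom C g = B \<otimes>\<^sub>o X"
    and cod: "Cod C f = Cod C g"
    and eq: "\<And>k. k < n \<Longrightarrow> f \<cdot> (Id C B \<otimes>\<^sub>m i k) = g \<cdot> (Id C B \<otimes>\<^sub>m i k)"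
  shows "f = g"
proof -
  have ip: "i j \<cdot> p j \<in> Hom C X X" if "j < n" for j
    using i[OF that] p[OF that] by (rule B.Comp_Hom[rotated])
  have expand: "h = finsum (hom_space C (B \<otimes>\<^sub>o X) (Cod C h)) (\<lambda>k. (h \<cdot> (Id C B \<otimes>\<^sub>m i k)) \<cdot> (Id C B \<otimes>\<^sub>m p k)) {..<n}"
    if h: "h \<in> Arr C" "Dom C h = B \<otimes>\<^sub>o X" for h
  proof -
    interpret H: abelian_group "hom_space C (B \<otimes>\<^sub>o X) (Cod C h)"
      using h B X by (simp add: hom_space_abelian_group)
    have "h = h \<cdot> (Id C B \<otimes>\<^sub>m finsum (hom_space C X X) (\<lambda>j. i j \<cdot> p j) {..<n})"
      using h B X by (simp add: sum)
    also have "\<dots> = h \<cdot> finsum (hom_space C (B \<otimes>\<^sub>o X) (B \<otimes>\<^sub>o X)) (\<lambda>j. Id C B \<otimes>\<^sub>m (i j \<cdot> p j)) {..<n}"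
      using B X ip by (simp add: Id_tensor_finsum)
    also have "\<dots> = finsum (hom_space C (B \<otimes>\<^sub>o X) (Cod C h)) (\<lambda>j. h \<cdot> (Id C B \<otimes>\<^sub>m (i j \<cdot> p j))) {..<n}"
      by (rule comp_finsum) (use B X h ip in \<open>simp_all add: Hom_iff\<close>)
    also have "\<dots> = finsum (hom_space C (B \<otimes>\<^sub>o X) (Cod C h))
        (\<lambda>k. (h \<cdot> (Id C B \<otimes>\<^sub>m i k)) \<cdot> (Id C B \<otimes>\<^sub>m p k)) {..<n}"
      by (rule H.finsum_cong') (use B X h i p in \<open>auto simp: Hom_iff whisker_left comp_assoc\<close>)
    finally show ?thesis .
  qed
  interpret H: abelian_group "hom_space C (B \<otimes>\<^sub>o X) (Cod C g)"
    using g B X by (simp add: hom_space_abelian_group)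
  have "f = finsum (hom_space C (B \<otimes>\<^sub>o X) (Cod C g)) (\<lambda>k. (f \<cdot> (Id C B \<otimes>\<^sub>m i k)) \<cdot> (Id C B \<otimes>\<^sub>m p k)) {..<n}"
    using expand[OF f] by (simp only: cod)
  also have "\<dots> = finsum (hom_space C (B \<otimes>\<^sub>o X) (Cod C g)) (\<lambda>k. (g \<cdot> (Id C B \<otimes>\<^sub>m i k)) \<cdot> (Id C B \<otimes>\<^sub>m p k)) {..<n}"
    by (rule H.finsum_cong') (use B X g i p eq in \<open>auto simp: Hom_iff\<close>)
  also have "\<dots> = g"
    by (rule expand[OF g, symmetric])
  finally show ?thesis .
qed

text \<open>The action on the sum of the underlying objects is built summand by summand. By the orthogonality of
  the \<open>i\<^sub>j\<close> and \<open>p\<^sub>j\<close> it restricts to \<open>m\<^sub>k\<close> on the k-th summand, i.e. each \<open>i\<^sub>k\<close> is a module map. Every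
  other equation (the module axioms, and that each \<open>p\<^sub>k\<close> is a module map) holds because it does so on the
  summands.\<close>

lemma direct_sum_Rep:
  assumes S: "\<And>j. j < n \<Longrightarrow> S j \<in> Rep_Obj C A"
  shows "\<exists>Y. is_direct_sum \<R> n S Y"
proof -
  define V where "V j = fst (S j)" for j
  define m where "m j = snd (S j)" for j
  have V: "V j \<in> Obj C" if "j < n" for j
    using S[OF that] by (simp add: V_def)
  have m: "m j \<in> Arr C" "Dom C (m j) = \<A> \<otimes>\<^sub>o V j" "Cod C (m j) = V j" if "j < n" for j
    using S[OF that] by (simp_all add: V_def m_def)
  have m_assoc: "m j \<cdot> (AMult A \<otimes>\<^sub>m Id C (V j)) = m j \<cdot> (Id C \<A> \<otimes>\<^sub>m m j) \<cdot> Assoc C \<A> \<A> (V j)"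
    and m_unit: "m j \<cdot> (AUnit A \<otimes>\<^sub>m Id C (V j)) = LUnit C (V j)" if "j < n" for j
    using S[OF that] by (simp_all add: V_def m_def module_assoc module_unit)
  obtain X i p where X: "X \<in> Obj C"
    and ip: "\<And>j. j < n \<Longrightarrow> i j \<in> Hom C (V j) X \<and> p j \<in> Hom C X (V j)"
    and delta: "\<And>j k. \<lbrakk>j < n; k < n\<rbrakk>
      \<Longrightarrow> p k \<cdot> i j = (if j = k then Id C (V j) else Zero C (V j) (V k))"
    and sum: "finsum (hom_space C X X) (\<lambda>j. i j \<cdot> p j) {..<n} = Id C X"
  proof -
    obtain X where "is_direct_sum C n V X"
      using direct_sum_exists[of n V] V by blast
    then show ?thesis
      using that unfolding is_direct_sum_def by blast
  qed
  have i: "i j \<in> Arr C" "Dom C (i j) = V j" "Cod C (i j) = X"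
    and p: "p j \<in> Arr C" "Dom C (p j) = X" "Cod C (p j) = V j" if "j < n" for j
    using ip[OF that] by (auto simp: Hom_iff)
  note t [simp] = X V m i p
  define \<mu> where "\<mu> = finsum (hom_space C (\<A> \<otimes>\<^sub>o X) X) (\<lambda>j. i j \<cdot> m j \<cdot> (Id C \<A> \<otimes>\<^sub>m p j)) {..<n}"
  have \<mu> [simp]: "\<mu> \<in> Arr C" "Dom C \<mu> = \<A> \<otimes>\<^sub>o X" "Cod C \<mu> = X"
    unfolding \<mu>_def by (rule finsum_typing; simp add: Hom_iff)+
  have summandwise: "f = g"
    if "B \<in> Obj C" "f \<in> Arr C" "Dom C f = B \<otimes>\<^sub>o X" "g \<in> Arr C" "Dom C g = B \<otimes>\<^sub>o X" "Cod C f = Cod C g"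
      "\<And>k. k < n \<Longrightarrow> f \<cdot> (Id C B \<otimes>\<^sub>m i k) = g \<cdot> (Id C B \<otimes>\<^sub>m i k)" for B f g
    by (rule tensor_direct_sum_ext[where i = i and p = p and V = V and n = n and B = B and X = X])
      (use that ip sum in auto)
  have \<mu>i: "\<mu> \<cdot> (Id C \<A> \<otimes>\<^sub>m i k) = i k \<cdot> m k" if k: "k < n" for k
  proof -
    have "\<mu> \<cdot> (Id C \<A> \<otimes>\<^sub>m i k) = finsum (hom_space C (\<A> \<otimes>\<^sub>o V k) X)
        (\<lambda>j. (i j \<cdot> m j \<cdot> (Id C \<A> \<otimes>\<^sub>m p j)) \<cdot> (Id C \<A> \<otimes>\<^sub>m i k)) {..<n}"
      unfolding \<mu>_def by (rule finsum_comp) (use k in \<open>simp_all add: Hom_iff\<close>)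
    also have "\<dots> = (i k \<cdot> m k \<cdot> (Id C \<A> \<otimes>\<^sub>m p k)) \<cdot> (Id C \<A> \<otimes>\<^sub>m i k)"
      by (rule finsum_single)
        (use k delta in \<open>simp_all add: Hom_iff comp_assoc interchange Id_tensor_Zero comp_Zero\<close>)
    also have "\<dots> = i k \<cdot> m k"
      using k delta by (simp add: comp_assoc interchange)
    finally show ?thesis .
  qed
  have XR: "(X, \<mu>) \<in> Rep_Obj C A"
  proof -
    have "\<mu> \<cdot> (AMult A \<otimes>\<^sub>m Id C X) = \<mu> \<cdot> (Id C \<A> \<otimes>\<^sub>m \<mu>) \<cdot> Assoc C \<A> \<A> X"
    proof (rule summandwise[of "\<A> \<otimes>\<^sub>o \<A>"])
      fix k assume k: "k < n"
      have "(\<mu> \<cdot> (AMult A \<otimes>\<^sub>m Id C X)) \<cdot> (Id C (\<A> \<otimes>\<^sub>o \<A>) \<otimes>\<^sub>m i k)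
          = (\<mu> \<cdot> (Id C \<A> \<otimes>\<^sub>m i k)) \<cdot> (AMult A \<otimes>\<^sub>m Id C (V k))"
        using k by (simp add: comp_assoc interchange)
      also have "\<dots> = i k \<cdot> m k \<cdot> (Id C \<A> \<otimes>\<^sub>m m k) \<cdot> Assoc C \<A> \<A> (V k)"
        using k by (simp add: \<mu>i comp_assoc m_assoc)
      also have "\<dots> = (\<mu> \<cdot> (Id C \<A> \<otimes>\<^sub>m i k)) \<cdot> (Id C \<A> \<otimes>\<^sub>m m k) \<cdot> Assoc C \<A> \<A> (V k)"
        using k by (simp add: \<mu>i comp_assoc)
      also have "\<dots> = \<mu> \<cdot> (Id C \<A> \<otimes>\<^sub>m (\<mu> \<cdot> (Id C \<A> \<otimes>\<^sub>m i k))) \<cdot> Assoc C \<A> \<A> (V k)"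
        using k by (simp add: \<mu>i comp_eq_prefix[OF \<mu>i] comp_assoc whisker_left)
      also have "\<dots> = (\<mu> \<cdot> (Id C \<A> \<otimes>\<^sub>m \<mu>) \<cdot> Assoc C \<A> \<A> X) \<cdot> ((Id C \<A> \<otimes>\<^sub>m Id C \<A>) \<otimes>\<^sub>m i k)"
        using k by (simp add: comp_assoc whisker_left assoc_nat del: tensor_id)
      finally show "(\<mu> \<cdot> (AMult A \<otimes>\<^sub>m Id C X)) \<cdot> (Id C (\<A> \<otimes>\<^sub>o \<A>) \<otimes>\<^sub>m i k)
          = (\<mu> \<cdot> (Id C \<A> \<otimes>\<^sub>m \<mu>) \<cdot> Assoc C \<A> \<A> X) \<cdot> (Id C (\<A> \<otimes>\<^sub>o \<A>) \<otimes>\<^sub>m i k)"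
        by simp
    qed simp_all
    moreover have "\<mu> \<cdot> (AUnit A \<otimes>\<^sub>m Id C X) = LUnit C X"
    proof (rule summandwise[of "Unit C"])
      fix k assume k: "k < n"
      have "(\<mu> \<cdot> (AUnit A \<otimes>\<^sub>m Id C X)) \<cdot> (Id C (Unit C) \<otimes>\<^sub>m i k)
          = (\<mu> \<cdot> (Id C \<A> \<otimes>\<^sub>m i k)) \<cdot> (AUnit A \<otimes>\<^sub>m Id C (V k))"
        using k by (simp add: comp_assoc interchange)
      also have "\<dots> = LUnit C X \<cdot> (Id C (Unit C) \<otimes>\<^sub>m i k)"
        using k by (simp add: \<mu>i comp_assoc LUnit_nat m_unit)
      finally show "(\<mu> \<cdot> (AUnit A \<otimes>\<^sub>m Id C X)) \<cdot> (Id C (Unit C) \<otimes>\<^sub>m i k)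
          = LUnit C X \<cdot> (Id C (Unit C) \<otimes>\<^sub>m i k)" .
    qed simp_all
    ultimately show ?thesis
      by (simp add: Rep_Obj_def Hom_iff)
  qed
  have \<mu>p: "p k \<cdot> \<mu> = m k \<cdot> (Id C \<A> \<otimes>\<^sub>m p k)" if k: "k < n" for k
  proof (rule summandwise[of \<A>])
    fix j assume j: "j < n"
    have "(p k \<cdot> \<mu>) \<cdot> (Id C \<A> \<otimes>\<^sub>m i j) = (p k \<cdot> i j) \<cdot> m j"
      using k j by (simp add: comp_assoc \<mu>i)
    also have "\<dots> = m k \<cdot> (Id C \<A> \<otimes>\<^sub>m (p k \<cdot> i j))"
      using k j by (simp add: delta Zero_comp comp_Zero Id_tensor_Zero)
    also have "\<dots> = (m k \<cdot> (Id C \<A> \<otimes>\<^sub>m p k)) \<cdot> (Id C \<A> \<otimes>\<^sub>m i j)"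
      using k j by (simp add: comp_assoc whisker_left)
    finally show "(p k \<cdot> \<mu>) \<cdot> (Id C \<A> \<otimes>\<^sub>m i j) = (m k \<cdot> (Id C \<A> \<otimes>\<^sub>m p k)) \<cdot> (Id C \<A> \<otimes>\<^sub>m i j)" .
  qed (use k in simp_all)
  let ?Y = "(X, \<mu>)"
  interpret R: linear_category \<R> by (rule linear_category_Rep)
  have iR: "(S j, i j, ?Y) \<in> Hom \<R> (S j) ?Y" and pR: "(?Y, p j, S j) \<in> Hom \<R> ?Y (S j)" if "j < n" for j
    using that XR S i[OF that] p[OF that] \<mu>i \<mu>p unfolding Rep_Hom_iff by (simp_all add: V_def m_def)
  have ipR: "(?Y, i j \<cdot> p j, ?Y) \<in> Hom \<R> ?Y ?Y" if "j < n" for j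
    using R.Comp_Hom[OF pR iR, OF that that] by simp
  \<comment> \<open>The sum of the \<open>i\<^sub>j \<cdot> p\<^sub>j\<close> in \<open>Rep A\<close> is computed by forgetting to \<open>C\<close>, which is additive.\<close>
  let ?s = "finsum (hom_space \<R> ?Y ?Y) (\<lambda>j. (?Y, i j \<cdot> p j, ?Y)) {..<n}"
  have "fst (snd ?s) = finsum (hom_space C X X) (\<lambda>j. fst (snd (?Y, i j \<cdot> p j, ?Y))) {..<n}"
  proof (rule additive_map_finsum[where h = "\<lambda>a. fst (snd a)"])
    show "abelian_group (hom_space \<R> ?Y ?Y)" "abelian_group (hom_space C X X)"
      using XR by (simp_all add: hom_space_abelian_group R.hom_space_abelian_group)
  qed (use ipR in \<open>auto elim!: Rep_HomE\<close>)
  moreover have "?s \<in> Hom \<R> ?Y ?Y"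
    using XR ipR R.finsum_typing[of ?Y ?Y n] by (simp add: Hom_iff[of _ \<R>])
  ultimately have "?s = Id \<R> ?Y"
    by (auto simp: sum elim!: Rep_HomE)
  then have "is_direct_sum \<R> n S ?Y"
    unfolding is_direct_sum_def using S XR iR pR delta
    by (intro conjI exI[of _ "\<lambda>j. (S j, i j, ?Y)"] exI[of _ "\<lambda>j. (?Y, p j, S j)"])
      (simp_all add: V_def)
  then show ?thesis
    by blast
qed

lemma additive_category_Rep: "additive_category \<R>"
  by (intro additive_category.intro additive_category_axioms.intro linear_category_Rep)
    (rule direct_sum_Rep, simp)


section \<open>The action on modules\<close>

text \<open>The algebra passes \<open>V\<close> along the braiding and then acts on \<open>X\<close>. The associativity and unit
  isomorphisms below are those of \<open>C\<close>, equipped with module structures on source and target.\<close>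

definition act_obj :: "'o \<Rightarrow> 'o \<times> 'm \<Rightarrow> 'o \<times> 'm" where
  "act_obj V X = (V \<otimes>\<^sub>o fst X, (Id C V \<otimes>\<^sub>m snd X) \<cdot> exchange \<A> V (fst X))"

definition act_hom ::
  "'m \<Rightarrow> ('o \<times> 'm) \<times> 'm \<times> ('o \<times> 'm) \<Rightarrow> ('o \<times> 'm) \<times> 'm \<times> ('o \<times> 'm)" where
  "act_hom f h = (act_obj (Dom C f) (Dom \<R> h), f \<otimes>\<^sub>m fst (snd h), act_obj (Cod C f) (Cod \<R> h))"

definition act_assoc where
  "act_assoc V W X = (act_obj (V \<otimes>\<^sub>o W) X, Assoc C V W (fst X), act_obj V (act_obj W X))"

definition act_unit where
  "act_unit X = (act_obj (Unit C) X, LUnit C (fst X), X)"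

lemma fst_act_obj [simp]: "fst (act_obj V X) = V \<otimes>\<^sub>o fst X"
  by (simp add: act_obj_def)

text \<open>After naturality of \<^const>\<open>exchange\<close> has moved the product (the unit) of \<open>A\<close> onto \<open>X\<close>, the module
  axioms of \<open>X\<close> apply there; multiplicativity (unitality) of \<^const>\<open>exchange\<close> in its first argument then
  turns the result into the required form.\<close>

lemma act_obj_Rep [simp]:
  assumes [simp]: "V \<in> Obj C" "X \<in> Rep_Obj C A"
  shows "act_obj V X \<in> Rep_Obj C A"
proof -
  let ?X = "fst X" and ?m = "snd X" and ?a = "Assoc C"
  let ?m' = "(Id C V \<otimes>\<^sub>m ?m) \<cdot> exchange \<A> V ?X"
  have "?m' \<cdot> (AMult A \<otimes>\<^sub>m Id C (V \<otimes>\<^sub>o ?X))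
      = (Id C V \<otimes>\<^sub>m ?m) \<cdot> exchange \<A> V ?X \<cdot> (AMult A \<otimes>\<^sub>m (Id C V \<otimes>\<^sub>m Id C ?X))"
    by (simp add: comp_assoc)
  also have "\<dots> = (Id C V \<otimes>\<^sub>m (?m \<cdot> (AMult A \<otimes>\<^sub>m Id C ?X))) \<cdot> exchange (\<A> \<otimes>\<^sub>o \<A>) V ?X"
    by (simp add: exchange_nat whisker_left comp_assoc del: tensor_id)
  also have "\<dots> = (Id C V \<otimes>\<^sub>m ?m) \<cdot> (Id C V \<otimes>\<^sub>m (Id C \<A> \<otimes>\<^sub>m ?m))
      \<cdot> (Id C V \<otimes>\<^sub>m ?a \<A> \<A> ?X) \<cdot> exchange (\<A> \<otimes>\<^sub>o \<A>) V ?X"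
    by (simp add: module_assoc whisker_left comp_assoc)
  also have "\<dots> = (Id C V \<otimes>\<^sub>m ?m) \<cdot> ((Id C V \<otimes>\<^sub>m (Id C \<A> \<otimes>\<^sub>m ?m)) \<cdot> exchange \<A> V (\<A> \<otimes>\<^sub>o ?X))
      \<cdot> (Id C \<A> \<otimes>\<^sub>m exchange \<A> V ?X) \<cdot> ?a \<A> \<A> (V \<otimes>\<^sub>o ?X)"
    by (simp add: exchange_tensor_left comp_assoc)
  also have "\<dots> = (Id C V \<otimes>\<^sub>m ?m) \<cdot> (exchange \<A> V ?X \<cdot> (Id C \<A> \<otimes>\<^sub>m (Id C V \<otimes>\<^sub>m ?m)))
      \<cdot> (Id C \<A> \<otimes>\<^sub>m exchange \<A> V ?X) \<cdot> ?a \<A> \<A> (V \<otimes>\<^sub>o ?X)"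
    by (simp add: exchange_nat)
  also have "\<dots> = ?m' \<cdot> (Id C \<A> \<otimes>\<^sub>m ?m') \<cdot> ?a \<A> \<A> (V \<otimes>\<^sub>o ?X)"
    by (simp add: whisker_left comp_assoc)
  finally have assoc_law: "?m' \<cdot> (AMult A \<otimes>\<^sub>m Id C (V \<otimes>\<^sub>o ?X)) = ?m' \<cdot> (Id C \<A> \<otimes>\<^sub>m ?m') \<cdot> ?a \<A> \<A> (V \<otimes>\<^sub>o ?X)" .
  have "?m' \<cdot> (AUnit A \<otimes>\<^sub>m Id C (V \<otimes>\<^sub>o ?X))
      = (Id C V \<otimes>\<^sub>m ?m) \<cdot> exchange \<A> V ?X \<cdot> (AUnit A \<otimes>\<^sub>m (Id C V \<otimes>\<^sub>m Id C ?X))"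
    by (simp add: comp_assoc)
  also have "\<dots> = (Id C V \<otimes>\<^sub>m (?m \<cdot> (AUnit A \<otimes>\<^sub>m Id C ?X))) \<cdot> exchange (Unit C) V ?X"
    by (simp add: exchange_nat whisker_left comp_assoc del: tensor_id)
  also have "\<dots> = LUnit C (V \<otimes>\<^sub>o ?X)"
    by (simp add: module_unit exchange_Unit_left)
  finally have unit_law: "?m' \<cdot> (AUnit A \<otimes>\<^sub>m Id C (V \<otimes>\<^sub>o ?X)) = LUnit C (V \<otimes>\<^sub>o ?X)" .
  show ?thesis
    unfolding Rep_Obj_def act_obj_def using assoc_law unit_law by (simp add: Hom_iff)
qed

lemma act_hom_Hom:
  assumes "f \<in> Hom C V V'" "h \<in> Hom \<R> X X'"
  shows "act_hom f h \<in> Hom \<R> (act_obj V X) (act_obj V' X')"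
proof -
  obtain k where h: "h = (X, k, X')" and X [simp]: "X \<in> Rep_Obj C A" "X' \<in> Rep_Obj C A"
    and k [simp]: "k \<in> Arr C" "Dom C k = fst X" "Cod C k = fst X'"
    and kX: "k \<cdot> snd X = snd X' \<cdot> (Id C \<A> \<otimes>\<^sub>m k)"
    using assms(2) unfolding Rep_Hom_iff by blast
  have f [simp]: "f \<in> Arr C" "Dom C f = V" "Cod C f = V'"
    using assms(1) by (simp_all add: Hom_iff)
  have o [simp]: "V \<in> Obj C" "V' \<in> Obj C"
    using f B.Dom_Obj B.Cod_Obj by blast+
  have "(f \<otimes>\<^sub>m k) \<cdot> (Id C V \<otimes>\<^sub>m snd X) \<cdot> exchange \<A> V (fst X)
      = (Id C V' \<otimes>\<^sub>m snd X') \<cdot> (f \<otimes>\<^sub>m (Id C \<A> \<otimes>\<^sub>m k)) \<cdot> exchange \<A> V (fst X)"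
    by (simp add: comp_eq_prefix[OF interchange] kX)
  also have "\<dots> = ((Id C V' \<otimes>\<^sub>m snd X') \<cdot> exchange \<A> V' (fst X')) \<cdot> (Id C \<A> \<otimes>\<^sub>m (f \<otimes>\<^sub>m k))"
    by (simp add: exchange_nat comp_assoc)
  finally show ?thesis
    unfolding Rep_Hom_iff by (simp add: h act_hom_def) (simp add: act_obj_def comp_assoc)
qed

text \<open>Only compatibility with \<open>A\<close> is at stake: it is the statement that \<open>A\<close> passes \<open>V \<otimes> W\<close> by passing
  \<open>V\<close> and then \<open>W\<close>.\<close>

lemma act_assoc_Iso:
  assumes [simp]: "V \<in> Obj C" "W \<in> Obj C" "X \<in> Rep_Obj C A"
  shows "act_assoc V W X \<in> Iso \<R> (act_obj (V \<otimes>\<^sub>o W) X) (act_obj V (act_obj W X))"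
  unfolding act_assoc_def
proof (rule Rep_IsoI)
  let ?X = "fst X" and ?m = "snd X"
  have "Assoc C V W ?X \<cdot> (Id C (V \<otimes>\<^sub>o W) \<otimes>\<^sub>m ?m) \<cdot> exchange \<A> (V \<otimes>\<^sub>o W) ?X
      = (Assoc C V W ?X \<cdot> ((Id C V \<otimes>\<^sub>m Id C W) \<otimes>\<^sub>m ?m)) \<cdot> exchange \<A> (V \<otimes>\<^sub>o W) ?X"
    by (simp add: comp_assoc)
  also have "\<dots> = (Id C V \<otimes>\<^sub>m (Id C W \<otimes>\<^sub>m ?m)) \<cdot> Assoc C V W (\<A> \<otimes>\<^sub>o ?X) \<cdot> exchange \<A> (V \<otimes>\<^sub>o W) ?X"
    by (simp add: assoc_nat comp_assoc del: tensor_id)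
  also have "\<dots> = (Id C V \<otimes>\<^sub>m ((Id C W \<otimes>\<^sub>m ?m) \<cdot> exchange \<A> W ?X)) \<cdot> exchange \<A> V (W \<otimes>\<^sub>o ?X)
      \<cdot> (Id C \<A> \<otimes>\<^sub>m Assoc C V W ?X)"
    by (simp add: exchange_tensor_right whisker_left comp_assoc)
  finally show "Assoc C V W ?X \<cdot> snd (act_obj (V \<otimes>\<^sub>o W) X)
      = snd (act_obj V (act_obj W X)) \<cdot> (Id C \<A> \<otimes>\<^sub>m Assoc C V W ?X)"
    by (simp add: act_obj_def comp_assoc)
qed (simp_all add: Assoc_Iso)

lemma act_unit_Iso:
  assumes [simp]: "X \<in> Rep_Obj C A"
  shows "act_unit X \<in> Iso \<R> (act_obj (Unit C) X) X"
  unfolding act_unit_def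
proof (rule Rep_IsoI)
  let ?X = "fst X" and ?m = "snd X"
  have "LUnit C ?X \<cdot> (Id C (Unit C) \<otimes>\<^sub>m ?m) \<cdot> exchange \<A> (Unit C) ?X
      = ?m \<cdot> LUnit C (\<A> \<otimes>\<^sub>o ?X) \<cdot> exchange \<A> (Unit C) ?X"
    by (simp add: comp_eq_prefix[OF LUnit_nat] comp_assoc)
  also have "\<dots> = ?m \<cdot> (Id C \<A> \<otimes>\<^sub>m LUnit C ?X)"
    by (simp add: exchange_Unit_right)
  finally show "LUnit C ?X \<cdot> snd (act_obj (Unit C) X) = ?m \<cdot> (Id C \<A> \<otimes>\<^sub>m LUnit C ?X)"
    by (simp add: act_obj_def)
qed (simp_all add: LUnit_Iso)

lemma additive_bifunctor_act: "additive_bifunctor C \<R> \<R> act_obj act_hom"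
proof (intro additive_bifunctor.intro bifunctor.intro bifunctor_axioms.intro
    additive_bifunctor_axioms.intro category_Rep linear_category_Rep
    B.category_axioms linear_category_axioms)
  show "act_obj V X \<in> Obj \<R>" if "V \<in> Obj C" "X \<in> Obj \<R>" for V X
    using that by simp
  show "act_hom f h \<in> Hom \<R> (act_obj V X) (act_obj V' X')"
    if "f \<in> Hom C V V'" "h \<in> Hom \<R> X X'" for f h V V' X X'
    using that by (rule act_hom_Hom)
  show "act_hom (Id C V) (Id \<R> X) = Id \<R> (act_obj V X)" if "V \<in> Obj C" "X \<in> Obj \<R>" for V X
    using that by (simp add: act_hom_def)
  show "act_hom (f' \<cdot> f) (h' \<cdot>\<^bsub>\<R>\<^esub> h) = act_hom f' h' \<cdot>\<^bsub>\<R>\<^esub> act_hom f h"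
    if "f \<in> Hom C V V'" "f' \<in> Hom C V' V''" "h \<in> Hom \<R> X X'" "h' \<in> Hom \<R> X' X''"
    for f f' h h' V V' V'' X X' X''
    using that by (elim Rep_HomE) (simp add: Hom_iff act_hom_def interchange)
  show "act_hom (Add C f f') h = Add \<R> (act_hom f h) (act_hom f' h)"
    if "f \<in> Hom C V V'" "f' \<in> Hom C V V'" "h \<in> Hom \<R> X X'" for f f' h V V' X X'
    using that Fm_Add_left by (elim Rep_HomE) (simp add: Hom_iff act_hom_def)
  show "act_hom f (Add \<R> h h') = Add \<R> (act_hom f h) (act_hom f h')"
    if "f \<in> Hom C V V'" "h \<in> Hom \<R> X X'" "h' \<in> Hom \<R> X X'" for f h h' V V' X X'
    using that Fm_Add_right by (elim Rep_HomE) (simp add: Hom_iff act_hom_def)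
qed

text \<open>With everything above in place, the remaining axioms are equations between underlying morphisms of \<open>C\<close>,
  where they are naturality, pentagon and triangle for \<open>C\<close>.\<close>

theorem module_category_Rep: "module_category C \<R> act_obj act_hom act_assoc act_unit"
proof (intro module_category.intro module_category_axioms.intro tensor_category_axioms
    additive_category_Rep additive_bifunctor_act)
  fix V W X assume "V \<in> Obj C" "W \<in> Obj C" "X \<in> Obj \<R>"
  then show "act_assoc V W X \<in> Iso \<R> (act_obj (V \<otimes>\<^sub>o W) X) (act_obj V (act_obj W X))"
    by (simp add: act_assoc_Iso)
next
  fix f g h V V' W W' X X' assume "f \<in> Hom C V V'" "g \<in> Hom C W W'" "h \<in> Hom \<R> X X'"
  then show "act_assoc V' W' X' \<cdot>\<^bsub>\<R>\<^esub> act_hom (f \<otimes>\<^sub>m g) h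
      = act_hom f (act_hom g h) \<cdot>\<^bsub>\<R>\<^esub> act_assoc V W X"
    by (elim Rep_HomE) (simp add: Hom_iff act_hom_def act_assoc_def assoc_nat)
next
  fix X assume "X \<in> Obj \<R>"
  then show "act_unit X \<in> Iso \<R> (act_obj (Unit C) X) X"
    by (simp add: act_unit_Iso)
next
  fix h X X' assume "h \<in> Hom \<R> X X'"
  then show "act_unit X' \<cdot>\<^bsub>\<R>\<^esub> act_hom (Id C (Unit C)) h = h \<cdot>\<^bsub>\<R>\<^esub> act_unit X"
    by (elim Rep_HomE) (simp add: Hom_iff act_hom_def act_unit_def LUnit_nat)
next
  fix U V W X assume "U \<in> Obj C" "V \<in> Obj C" "W \<in> Obj C" "X \<in> Obj \<R>"
  then show "act_assoc U V (act_obj W X) \<cdot>\<^bsub>\<R>\<^esub> act_assoc (U \<otimes>\<^sub>o V) W X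
      = act_hom (Id C U) (act_assoc V W X) \<cdot>\<^bsub>\<R>\<^esub> act_assoc U (V \<otimes>\<^sub>o W) X
        \<cdot>\<^bsub>\<R>\<^esub> act_hom (Assoc C U V W) (Id \<R> X)"
    by (simp add: act_hom_def act_assoc_def pentagon)
next
  fix V X assume "V \<in> Obj C" "X \<in> Obj \<R>"
  then show "act_hom (Id C V) (act_unit X) \<cdot>\<^bsub>\<R>\<^esub> act_assoc V (Unit C) X
      = act_hom (RUnit C V) (Id \<R> X)"
    by (simp add: act_hom_def act_assoc_def act_unit_def triangle)
qed

end

theorem corollary1p7:
  fixes C :: "('o, 'm, 'z) bal_cat_scheme" and A :: "('o, 'm, 'y) cat_algebra_scheme"
  assumes "semisimple_rigid_balanced_braided_tensor_category C"
    and "is_simple C (Unit C)"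
    and "C_algebra C A"
  shows "\<exists>actO actM actAssoc actUnit. module_category C (Rep C A) actO actM actAssoc actUnit"
proof -
  interpret semisimple_rigid_balanced_braided_tensor_category C by fact
  interpret C_algebra C A by fact
  interpret algebra_modules C A by unfold_locales
  show ?thesis
    using module_category_Rep by blast
qed

end
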